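(* Let $\mathbb{K}$ be a field of characteristic zero and let $\mathcal{A}$ be a line arrangement in $\mathbf{P}^2_{\mathbb{K}}$ with $r=\mathrm{mdr}(\mathcal{A})$. If there is $H\in\mathcal{A}$ with $|\mathcal{A}^H|=k>r$, then $n_2(H)\ge k-r$. Moreover, setting $\mathcal{A}_{>r}:=\{L\in\mathcal{A}\mid |\mathcal{A}^L|>r\}$, $$n_2(\mathcal{A})\ge\frac12\sum_{L\in\mathcal{A}_{>r}}(|\mathcal{A}^L|-r).$$ In particular $n_2(\mathcal{A})\ge\frac{|\mathcal{A}_{>r}|}{2}$, and $n_2(\mathcal{A})>0$ if $\mathcal{A}_{>r}\neq\emptyset$.
   Context: $S=\mathbb{K}[x,y,z]$, $\mathrm{Der}\,S=S\partial_x\oplus S\partial_y\oplus S\partial_z$, graded by degree of coefficients. A line arrangement $\mathcal{A}$ is a finite set of lines in $\mathbf{P}^2_{\mathbb{K}}$ (planes through $0$ in $\mathbb{K}^3$), each $L$ defined by a linear form $\alpha_L$; standing assumption: the lines do not all pass through one common point. $D(\mathcal{A})=\{\theta\in\mathrm{Der}\,S\mid\theta(\alpha_L)\in S\alpha_L\ \forall L\in\mathcal{A}\}$, and for $L\in\mathcal{A}$, $D_L(\mathcal{A})=\{\theta\in D(\mathcal{A})\mid\theta(\alpha_L)=0\}$ (its isomorphism type as graded module does not depend on $L$). $\mathrm{mdr}(\mathcal{A})=\min\{d\mid D_L(\mathcal{A})_d\neq0\}$. $L_2(\mathcal{A})$ is the set of points that are intersections of at least two lines; for $L\in\mathcal{A}$,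 $\mathcal{A}^L=\{q\in L_2(\mathcal{A})\mid q\in L\}$. A double point is a point through which exactly two lines of $\mathcal{A}$ pass; $n_2(\mathcal{A})$ is the number of double points and $n_2(H)$ the number of double points on $H$. *)

theory Defs
  imports "HOL-Analysis.Analysis" "HOL-Library.Poly_Mapping"
begin

text \<open>
  The polynomial ring in three variables over \<open>'k\<close>: finitely supported maps from exponent vectors
  to coefficients, with the convolution product of \<^theory>\<open>HOL-Library.Poly_Mapping\<close>.
  The three elements of the index type \<open>3\<close> stand for the variables \<open>x, y, z\<close>.
\<close>

type_synonym 'k poly3 = "(3 \<Rightarrow>\<^sub>0 nat) \<Rightarrow>\<^sub>0 'k"

definition homogeneous :: "nat \<Rightarrow> 'k::zero poly3 \<Rightarrow> bool" where
  "homogeneous d f \<longleftrightarrow>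
     (\<forall>m \<in> Poly_Mapping.keys f. (\<Sum>i\<in>UNIV. Poly_Mapping.lookup m i) = d)"

text \<open>
  In the formal partial derivative, the truncated subtraction on exponents only matters for
  monomials not containing the variable, and those get coefficient \<open>0\<close>.
\<close>

definition partial_deriv :: "3 \<Rightarrow> 'k::comm_semiring_1 poly3 \<Rightarrow> 'k poly3" where
  "partial_deriv i f =
     (\<Sum>m \<in> Poly_Mapping.keys f.
        Poly_Mapping.single (m - Poly_Mapping.single i 1)
          (of_nat (Poly_Mapping.lookup m i) * Poly_Mapping.lookup f m))"

text \<open>
  \<open>Der S\<close> is free on the partial derivatives; a derivation is given by its coefficient vector.
\<close>

type_synonym 'k deriv3 = "'k poly3 ^ 3"

definition der_apply :: "'k::comm_semiring_1 deriv3 \<Rightarrow> 'k poly3 \<Rightarrow> 'k poly3" where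
  "der_apply \<theta> f = (\<Sum>i\<in>UNIV. \<theta> $ i * partial_deriv i f)"

definition linear_form :: "'k::comm_semiring_1 ^ 3 \<Rightarrow> 'k poly3" where
  "linear_form a = (\<Sum>i\<in>UNIV. Poly_Mapping.single (Poly_Mapping.single i 1) (a $ i))"

text \<open>
  Points and lines of the projective plane are the linear subspaces of \<open>'k ^ 3\<close> of dimension 1
  and 2; a point \<open>p\<close> lies on a line \<open>L\<close> iff \<open>p \<subseteq> L\<close>.
\<close>

definition proj_point :: "('k::field ^ 3) set \<Rightarrow> bool" where
  "proj_point p \<longleftrightarrow> vec.subspace p \<and> vec.dim p = 1"

definition proj_line :: "('k::field ^ 3) set \<Rightarrow> bool" where
  "proj_line L \<longleftrightarrow> vec.subspace L \<and> vec.dim L = 2"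

text \<open>
  The linear form defining the line \<open>L\<close> is recorded by its coefficient vector \<open>\<alpha> L\<close>; as \<open>L\<close> is
  two-dimensional, the last condition forces \<open>\<alpha> L \<noteq> 0\<close>.
\<close>

definition line_arrangement ::
    "('k::field ^ 3) set set \<Rightarrow> (('k ^ 3) set \<Rightarrow> 'k ^ 3) \<Rightarrow> bool" where
  "line_arrangement \<A> \<alpha> \<longleftrightarrow>
     finite \<A> \<and>
     (\<forall>L\<in>\<A>. proj_line L) \<and>
     (\<nexists>p. proj_point p \<and> (\<forall>L\<in>\<A>. p \<subseteq> L)) \<and>
     (\<forall>L\<in>\<A>. L = {v. (\<Sum>i\<in>UNIV. \<alpha> L $ i * v $ i) = 0})"

definition log_derivations ::
    "('k::field ^ 3) set set \<Rightarrow> (('k ^ 3) set \<Rightarrow> 'k ^ 3) \<Rightarrow> 'k deriv3 set" where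
  "log_derivations \<A> \<alpha> =
     {\<theta>. \<forall>L\<in>\<A>. linear_form (\<alpha> L) dvd der_apply \<theta> (linear_form (\<alpha> L))}"

definition log_derivations_at ::
    "('k::field ^ 3) set set \<Rightarrow> (('k ^ 3) set \<Rightarrow> 'k ^ 3) \<Rightarrow> ('k ^ 3) set \<Rightarrow> 'k deriv3 set" where
  "log_derivations_at \<A> \<alpha> L =
     {\<theta> \<in> log_derivations \<A> \<alpha>. der_apply \<theta> (linear_form (\<alpha> L)) = 0}"

definition graded_part :: "nat \<Rightarrow> 'k::zero deriv3 set \<Rightarrow> 'k deriv3 set" where
  "graded_part d M = {\<theta> \<in> M. \<forall>i. homogeneous d (\<theta> $ i)}"

text \<open>
  The auxiliary line \<open>L\<close> is kept as a parameter; the value does not depend on the choice of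
  \<open>L \<in> \<A>\<close>, because the graded modules \<open>log_derivations_at \<A> \<alpha> L\<close> are all isomorphic.
\<close>

definition mdr ::
    "('k::field ^ 3) set set \<Rightarrow> (('k ^ 3) set \<Rightarrow> 'k ^ 3) \<Rightarrow> ('k ^ 3) set \<Rightarrow> nat" where
  "mdr \<A> \<alpha> L = (LEAST d. graded_part d (log_derivations_at \<A> \<alpha> L) \<noteq> {0})"

definition lines_through :: "('k::field ^ 3) set set \<Rightarrow> ('k ^ 3) set \<Rightarrow> ('k ^ 3) set set" where
  "lines_through \<A> p = {L\<in>\<A>. p \<subseteq> L}"

definition intersection_points :: "('k::field ^ 3) set set \<Rightarrow> ('k ^ 3) set set" where
  "intersection_points \<A> = {p. proj_point p \<and> card (lines_through \<A> p) \<ge> 2}"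

definition restriction :: "('k::field ^ 3) set set \<Rightarrow> ('k ^ 3) set \<Rightarrow> ('k ^ 3) set set" where
  "restriction \<A> L = {q \<in> intersection_points \<A>. q \<subseteq> L}"

definition double_points :: "('k::field ^ 3) set set \<Rightarrow> ('k ^ 3) set set" where
  "double_points \<A> = {p. proj_point p \<and> card (lines_through \<A> p) = 2}"

definition n2 :: "('k::field ^ 3) set set \<Rightarrow> nat" where
  "n2 \<A> = card (double_points \<A>)"

definition n2_on :: "('k::field ^ 3) set set \<Rightarrow> ('k ^ 3) set \<Rightarrow> nat" where
  "n2_on \<A> H = card {p \<in> double_points \<A>. p \<subseteq> H}"

definition lines_gt :: "('k::field ^ 3) set set \<Rightarrow> nat \<Rightarrow> ('k ^ 3) set set" where
  "lines_gt \<A> r = {L\<in>\<A>. card (restriction \<A> L) > r}"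

end

theory Submission
  imports Defs "HOL-Computational_Algebra.Polynomial"
begin

text \<open>
  Let \<open>\<theta>\<close> be a derivation of minimal degree \<open>r\<close> killing \<open>\<alpha>\<^sub>H\<close>. On an affine line \<open>v\<^sub>2 + t v\<^sub>1\<close> of the
  plane \<open>H\<close> meeting all intersection points on \<open>H\<close> it has the form \<open>F(t) v\<^sub>1 + G(t) v\<^sub>2\<close> with \<open>deg F, deg G \<le> r\<close>.
  At a point \<open>t\<^sub>0\<close> lying on two further lines, \<open>F - t\<^sub>0 G\<close> has a double zero at \<open>t\<^sub>0\<close>, so \<open>F - t G\<close> and
  \<open>F' - t G'\<close> vanish there. More than \<open>r\<close> such points would force \<open>F' = t G'\<close>, hence \<open>deg G < r\<close> as
  \<open>r \<ge> 1\<close>, hence \<open>F = t G\<close> and \<open>F = G = 0\<close>. But then \<open>\<alpha>\<^sub>H\<close> divides \<open>\<theta>\<close>, contradicting minimality.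
  So all but at most \<open>r\<close> of the points on \<open>H\<close> are double; summing over \<open>H\<close> counts each double point
  twice.
\<close>

subsection \<open>Evaluation of polynomials\<close>

text \<open>Coefficient embeddings, evaluations and substitutions are all instances, so one set of
  rules for sums, powers and products serves them all.\<close>

locale unital_hom =
  fixes h :: "'a::comm_ring_1 \<Rightarrow> 'b::comm_ring_1"
  assumes hom_one: "h 1 = 1"
    and hom_add: "h (a + b) = h a + h b"
    and hom_mult: "h (a * b) = h a * h b"
begin

lemma hom_zero: "h 0 = 0"
  using hom_add[of 0 0] by simp

lemma hom_sum: "h (sum f A) = (\<Sum>x\<in>A. h (f x))"
  by (induction A rule: infinite_finite_induct) (auto simp: hom_zero hom_add)

lemma hom_power: "h (a ^ n) = h a ^ n"
  by (induction n) (auto simp: hom_one hom_mult)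

lemma hom_prod: "h (prod f A) = (\<Prod>x\<in>A. h (f x))"
  by (induction A rule: infinite_finite_induct) (auto simp: hom_one hom_mult)

end

lemma unital_hom_id: "unital_hom id"
  by unfold_locales auto

lemma unital_hom_pCons: "unital_hom (\<lambda>c. [:c:])"
  by unfold_locales auto

lemma unital_hom_poly: "unital_hom (\<lambda>p. poly p s)"
  by unfold_locales auto

lemma unital_hom_single_0:
  "unital_hom (Poly_Mapping.single 0 :: 'k::comm_ring_1 \<Rightarrow> 'm::comm_monoid_add \<Rightarrow>\<^sub>0 'k)"
  by unfold_locales (auto simp: single_add mult_single)

lemma poly_mapping_eq_sum_single:
  fixes f :: "'a \<Rightarrow>\<^sub>0 'b::comm_monoid_add"
  assumes "finite A" "Poly_Mapping.keys f \<subseteq> A"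
  shows "f = (\<Sum>m\<in>A. Poly_Mapping.single m (Poly_Mapping.lookup f m))"
proof (rule poly_mapping_eqI)
  fix k
  have "(\<Sum>m\<in>A. Poly_Mapping.lookup (Poly_Mapping.single m (Poly_Mapping.lookup f m)) k)
      = (\<Sum>m\<in>A. if k = m then Poly_Mapping.lookup f m else 0)"
    by (intro sum.cong) (auto simp: lookup_single when_def)
  also have "\<dots> = Poly_Mapping.lookup f k"
    using assms by (subst sum.delta') (auto simp: in_keys_iff)
  finally show "Poly_Mapping.lookup f k = Poly_Mapping.lookup
      (\<Sum>m\<in>A. Poly_Mapping.single m (Poly_Mapping.lookup f m)) k"
    by (simp add: lookup_sum)
qed

text \<open>A finitely supported map is a finite sum of \<open>single\<close> terms. The zero map
  needs no case of its own: it is a \<open>single\<close> with coefficient 0.\<close>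

lemma poly_mapping_single_induct [case_names single add]:
  fixes f :: "'a \<Rightarrow>\<^sub>0 'b::comm_monoid_add"
  assumes single: "\<And>m c. P (Poly_Mapping.single m c)"
    and add: "\<And>f g. P f \<Longrightarrow> P g \<Longrightarrow> P (f + g)"
  shows "P f"
proof -
  have "P (\<Sum>m\<in>A. Poly_Mapping.single m (Poly_Mapping.lookup f m))" if "finite A" for A
    using that
  proof induction
    case empty
    show ?case using single[of undefined 0] by simp
  qed (auto intro: single add)
  then show ?thesis
    using poly_mapping_eq_sum_single[of "Poly_Mapping.keys f" f] by (metis finite_keys order_refl)
qed

section \<open>Substitution into polynomials\<close>

definition monom_at :: "('x::finite \<Rightarrow> 'r::comm_ring_1) \<Rightarrow> ('x \<Rightarrow>\<^sub>0 nat) \<Rightarrow> 'r" where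
  "monom_at X m = (\<Prod>i\<in>UNIV. X i ^ Poly_Mapping.lookup m i)"

text \<open>The map given by the universal property of the polynomial ring: \<open>h\<close> acts on
  coefficients and \<open>X i\<close> replaces variable \<open>i\<close>. Evaluation at a vector,
  restriction to a line, Kronecker substitution and elimination of a variable are all of this
  form.\<close>

definition insertion ::
    "('k::comm_ring_1 \<Rightarrow> 'r::comm_ring_1) \<Rightarrow> ('x::finite \<Rightarrow> 'r) \<Rightarrow> (('x \<Rightarrow>\<^sub>0 nat) \<Rightarrow>\<^sub>0 'k) \<Rightarrow> 'r" where
  "insertion h X f = (\<Sum>m\<in>Poly_Mapping.keys f. h (Poly_Mapping.lookup f m) * monom_at X m)"

lemma monom_at_0: "monom_at X 0 = 1"
  by (simp add: monom_at_def)

lemma monom_at_add: "monom_at X (m + n) = monom_at X m * monom_at X n"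
  by (simp add: monom_at_def lookup_add power_add prod.distrib)

lemma monom_at_single: "monom_at X (Poly_Mapping.single i n) = X i ^ n"
proof -
  have "monom_at X (Poly_Mapping.single i n) = (\<Prod>j\<in>UNIV. if i = j then X j ^ n else 1)"
    unfolding monom_at_def by (intro prod.cong) (auto simp: lookup_single when_def)
  then show ?thesis by simp
qed

lemma monom_at_mult:
  "monom_at (\<lambda>i. c * X i) m = c ^ (\<Sum>i\<in>UNIV. Poly_Mapping.lookup m i) * monom_at X m"
  by (simp add: monom_at_def power_mult_distrib prod.distrib power_sum)

context unital_hom
begin

lemma hom_monom_at: "h (monom_at X m) = monom_at (\<lambda>i. h (X i)) m"
  by (simp add: monom_at_def hom_prod hom_power)

text \<open>Coefficients outside the support contribute \<open>h 0 = 0\<close>, so two polynomials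
  can be summed over a common index set.\<close>

lemma insertion_superset:
  assumes "finite A" "Poly_Mapping.keys f \<subseteq> A"
  shows "insertion h X f = (\<Sum>m\<in>A. h (Poly_Mapping.lookup f m) * monom_at X m)"
  unfolding insertion_def using assms
  by (intro sum.mono_neutral_left) (auto simp: in_keys_iff hom_zero)

lemma insertion_single: "insertion h X (Poly_Mapping.single m c) = h c * monom_at X m"
  by (subst insertion_superset[of "{m}"]) auto

lemma insertion_add: "insertion h X (f + g) = insertion h X f + insertion h X g"
proof -
  let ?A = "Poly_Mapping.keys f \<union> Poly_Mapping.keys g"
  have "Poly_Mapping.keys (f + g) \<subseteq> ?A"
    by (rule Poly_Mapping.keys_add)
  then show ?thesis
    by (simp add: insertion_superset[of ?A] lookup_add hom_add distrib_right sum.distrib)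
qed

lemma insertion_mult: "insertion h X (f * g) = insertion h X f * insertion h X g"
proof (induction f rule: poly_mapping_single_induct)
  case (single m c)
  show ?case
    by (induction g rule: poly_mapping_single_induct)
      (auto simp: mult_single insertion_single hom_mult monom_at_add distrib_left insertion_add)
qed (simp add: distrib_right insertion_add)

lemma unital_hom_insertion: "unital_hom (insertion h X)"
proof
  show "insertion h X 1 = 1"
    unfolding single_one[symmetric] by (simp only: insertion_single hom_one monom_at_0) simp
qed (auto simp: insertion_add insertion_mult)

lemma insertion_linear_form:
  "insertion h X (linear_form a) = (\<Sum>i\<in>UNIV. h (a $ i) * X i)"
  unfolding linear_form_def unital_hom.hom_sum[OF unital_hom_insertion]
  by (simp add: insertion_single monom_at_single)

end

text \<open>A homomorphism after a substitution is again a substitution; this is how values of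
  substituted polynomials reduce to \<open>eval_at\<close>.\<close>

lemma hom_insertion:
  assumes "unital_hom \<phi>"
  shows "\<phi> (insertion h X f) = insertion (\<lambda>c. \<phi> (h c)) (\<lambda>i. \<phi> (X i)) f"
  by (simp add: insertion_def unital_hom.hom_sum[OF assms] unital_hom.hom_mult[OF assms]
      unital_hom.hom_monom_at[OF assms])

definition var :: "'x \<Rightarrow> ('x \<Rightarrow>\<^sub>0 nat) \<Rightarrow>\<^sub>0 'k::comm_ring_1" where
  "var i = Poly_Mapping.single (Poly_Mapping.single i 1) 1"

lemma monom_at_var:
  fixes m :: "'x::finite \<Rightarrow>\<^sub>0 nat"
  shows "monom_at var m = (Poly_Mapping.single m 1 :: ('x \<Rightarrow>\<^sub>0 nat) \<Rightarrow>\<^sub>0 'k::comm_ring_1)"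
proof (induction m rule: poly_mapping_single_induct)
  case (single i n)
  have "(var i ^ n :: ('x \<Rightarrow>\<^sub>0 nat) \<Rightarrow>\<^sub>0 'k) = Poly_Mapping.single (Poly_Mapping.single i n) 1"
    by (induction n) (auto simp: var_def mult_single single_add[symmetric])
  then show ?case by (simp add: monom_at_single)
qed (simp add: monom_at_add mult_single)

lemma insertion_var: "insertion (Poly_Mapping.single 0) var f = f"
  unfolding insertion_def monom_at_var using poly_mapping_eq_sum_single[of "Poly_Mapping.keys f" f]
  by (simp add: mult_single)

section \<open>Congruence of substitutions modulo a divisor\<close>

lemma dvd_power_diff:
  fixes d :: "'r::comm_ring_1"
  assumes "d dvd x - y"
  shows "d dvd x ^ n - y ^ n"
  using assms by (simp add: power_diff_sumr2)

lemma dvd_prod_diff: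
  fixes d :: "'r::comm_ring_1"
  assumes "\<And>i. d dvd F i - G i"
  shows "d dvd prod F A - prod G A"
proof (induction A rule: infinite_finite_induct)
  case (insert x A)
  have "prod F (insert x A) - prod G (insert x A)
      = (F x - G x) * prod F A + G x * (prod F A - prod G A)"
    using insert.hyps by (simp add: algebra_simps)
  then show ?case using assms[of x] insert.IH by simp
qed auto

text \<open>Congruence modulo \<open>d\<close> passes through powers, products and sums with fixed
  coefficients.\<close>

lemma dvd_insertion_diff:
  fixes d :: "'r::comm_ring_1"
  assumes "\<And>i. d dvd X i - Y i"
  shows "d dvd insertion h X f - insertion h Y f"
proof -
  have "d dvd monom_at X m - monom_at Y m" for m
    unfolding monom_at_def by (intro dvd_prod_diff dvd_power_diff assms)
  then show ?thesis
    unfolding insertion_def sum_subtractf[symmetric] right_diff_distrib[symmetric]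
    by (intro dvd_sum) simp
qed

lemma single_eq_0_iff: "Poly_Mapping.single k c = 0 \<longleftrightarrow> c = 0"
  by (metis lookup_single_eq lookup_zero single_zero)

section \<open>Evaluation at a vector and restriction to an affine line\<close>

definition dot :: "'k::comm_semiring_1 ^ 'n \<Rightarrow> 'k ^ 'n \<Rightarrow> 'k" where
  "dot a v = (\<Sum>i\<in>UNIV. a $ i * v $ i)"

lemma dot_add: "dot a (v + w) = dot a v + dot a w"
  by (simp add: dot_def distrib_left sum.distrib)

lemma dot_mult: "dot a (c *s v) = c * dot a v"
  by (simp add: dot_def sum_distrib_left mult.left_commute)

lemma dot_zero: "dot a 0 = 0"
  by (simp add: dot_def)

definition eval_at :: "'k::comm_ring_1 ^ 'n \<Rightarrow> (('n \<Rightarrow>\<^sub>0 nat) \<Rightarrow>\<^sub>0 'k) \<Rightarrow> 'k" where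
  "eval_at v = insertion id (\<lambda>i. v $ i)"

text \<open>The restriction of a polynomial to the affine line \<open>q + s *s w\<close>, as a
  polynomial in the parameter \<open>s\<close>.\<close>

definition along :: "'k::comm_ring_1 ^ 'n \<Rightarrow> 'k ^ 'n \<Rightarrow> (('n \<Rightarrow>\<^sub>0 nat) \<Rightarrow>\<^sub>0 'k) \<Rightarrow> 'k poly" where
  "along q w = insertion (\<lambda>c. [:c:]) (\<lambda>i. [:q $ i, w $ i:])"

lemma unital_hom_eval_at: "unital_hom (eval_at v)"
  unfolding eval_at_def by (rule unital_hom.unital_hom_insertion[OF unital_hom_id])

lemmas eval_at_hom =
  unital_hom.hom_zero[OF unital_hom_eval_at] unital_hom.hom_one[OF unital_hom_eval_at]
  unital_hom.hom_add[OF unital_hom_eval_at] unital_hom.hom_mult[OF unital_hom_eval_at]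
  unital_hom.hom_sum[OF unital_hom_eval_at] unital_hom.hom_prod[OF unital_hom_eval_at]

lemma eval_at_single_0: "eval_at v (Poly_Mapping.single 0 c) = c"
  by (simp add: eval_at_def unital_hom.insertion_single[OF unital_hom_id] monom_at_0)

lemma eval_at_linear_form: "eval_at v (linear_form a) = dot a v"
  by (simp add: eval_at_def unital_hom.insertion_linear_form[OF unital_hom_id] dot_def)

lemma poly_along: "poly (along q w f) s = eval_at (q + s *s w) f"
proof -
  have "poly (along q w f) s = insertion (\<lambda>c. poly [:c:] s) (\<lambda>i. poly [:q $ i, w $ i:] s) f"
    unfolding along_def by (rule hom_insertion[OF unital_hom_poly])
  then show ?thesis by (simp add: eval_at_def id_def)
qed

lemma eval_at_homogeneous:
  assumes "homogeneous d f"
  shows "eval_at (c *s v) f = c ^ d * eval_at v f"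
  using assms
  by (simp add: eval_at_def insertion_def monom_at_mult homogeneous_def sum_distrib_left
      mult.left_commute)

text \<open>Each variable becomes a polynomial of degree at most 1, so a monomial of total degree
  \<open>d\<close> contributes degree at most \<open>d\<close>.\<close>

lemma degree_along_le:
  fixes f :: "'k::comm_ring_1 poly3"
  assumes "homogeneous d f"
  shows "degree (along q w f) \<le> d"
  unfolding along_def insertion_def
proof (intro degree_sum_le)
  fix m assume m: "m \<in> Poly_Mapping.keys f"
  have "degree (monom_at (\<lambda>i. [:q $ i, w $ i:]) m)
      \<le> (\<Sum>i\<in>UNIV. degree ([:q $ i, w $ i:] ^ Poly_Mapping.lookup m i))"
    unfolding monom_at_def by (rule degree_prod_sum_le[unfolded o_def]) simp
  also have "\<dots> \<le> (\<Sum>i\<in>UNIV. Poly_Mapping.lookup m i)"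
  proof (rule sum_mono)
    fix i
    have "degree ([:q $ i, w $ i:] ^ Poly_Mapping.lookup m i)
        \<le> degree [:q $ i, w $ i:] * Poly_Mapping.lookup m i"
      by (rule degree_power_le)
    also have "\<dots> \<le> 1 * Poly_Mapping.lookup m i"
      by (rule mult_right_mono) auto
    finally show "degree ([:q $ i, w $ i:] ^ Poly_Mapping.lookup m i) \<le> Poly_Mapping.lookup m i"
      by simp
  qed
  finally show "degree ([:Poly_Mapping.lookup f m:] * monom_at (\<lambda>i. [:q $ i, w $ i:]) m) \<le> d"
    using assms m by (auto simp: homogeneous_def intro: order_trans[OF degree_smult_le])
qed simp

text \<open>Uniqueness of digits in base \<open>N\<close>: reduction modulo \<open>N\<close>
  recovers the lowest digit, and the argument repeats on the quotient.\<close>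

lemma base_expansion_unique:
  fixes N :: nat
  assumes "a < N" "b < N" "c < N" "a' < N" "b' < N" "c' < N"
    and "a + N * (b + N * c) = a' + N * (b' + N * c')"
  shows "a = a' \<and> b = b' \<and> c = c'"
proof -
  have 1: "x = x' \<and> y = y'" if "x < N" "x' < N" "x + N * y = x' + N * y'" for x x' y y'
  proof -
    have "x = x'"
      using that by (metis mod_less mod_mult_self2)
    then show ?thesis using that by simp
  qed
  show ?thesis
    using 1[of a a' "b + N * c" "b' + N * c'"] 1[of b b' c c'] assms by auto
qed

lemma prod_UNIV_3: "prod f (UNIV :: 3 set) = f 1 * f 2 * f 3"
  unfolding UNIV_3 by (simp add: ac_simps)

text \<open>
  Kronecker substitution \<open>x \<mapsto> t, y \<mapsto> t^N, z \<mapsto> t^(N^2)\<close> with \<open>N\<close> above all exponents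
  reduces the claim to polynomials in one variable.
\<close>

lemma eval_at_zero_imp_zero:
  fixes f :: "'k::{ring_char_0, idom} poly3"
  assumes "\<And>v. eval_at v f = 0"
  shows "f = 0"
proof (rule ccontr)
  assume "f \<noteq> 0"
  then obtain m0 where m0: "m0 \<in> Poly_Mapping.keys f"
    by (metis equals0I keys_eq_empty)
  define N where
    "N = Suc (Max ((\<lambda>(m, i). Poly_Mapping.lookup m i) ` (Poly_Mapping.keys f \<times> (UNIV :: 3 set))))"
  have N: "Poly_Mapping.lookup m i < N" if "m \<in> Poly_Mapping.keys f" for m i
    unfolding N_def less_Suc_eq_le using that by (intro Max_ge) force+
  define e :: "(3 \<Rightarrow>\<^sub>0 nat) \<Rightarrow> nat" where
    "e m = Poly_Mapping.lookup m 1
      + N * (Poly_Mapping.lookup m 2 + N * Poly_Mapping.lookup m 3)" for m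
  have e_inj: "m = m0" if m: "m \<in> Poly_Mapping.keys f" and "e m = e m0" for m
  proof (rule poly_mapping_eqI)
    fix i :: 3
    show "Poly_Mapping.lookup m i = Poly_Mapping.lookup m0 i"
      using base_expansion_unique[OF N[OF m] N[OF m] N[OF m] N[OF m0] N[OF m0] N[OF m0]]
        \<open>e m = e m0\<close> exhaust_3[of i] unfolding e_def by metis
  qed
  define X :: "3 \<Rightarrow> 'k poly" where
    "X i = monom 1 (if i = 1 then 1 else if i = 2 then N else N ^ 2)" for i
  define p where "p = insertion (\<lambda>c. [:c:]) X f"
  have "poly p t = 0" for t
  proof -
    have "poly p t = eval_at (\<chi> i. poly (X i) t) f"
      using hom_insertion[OF unital_hom_poly[of t], of "\<lambda>c. [:c:]" X f]
      by (simp add: eval_at_def p_def id_def)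
    then show ?thesis using assms by simp
  qed
  then have "p = 0"
    using poly_all_0_iff_0 by blast
  have "monom_at X m = monom 1 (e m)" for m
  proof -
    have "(2::3) \<noteq> 1" "(3::3) \<noteq> 1" "(3::3) \<noteq> 2"
      by simp_all
    then have X: "X 1 = monom 1 1" "X 2 = monom 1 N"
      "X 3 = monom 1 (N ^ 2)"
      unfolding X_def by presburger+
    have "monom_at X m = X 1 ^ Poly_Mapping.lookup m 1 * X 2 ^ Poly_Mapping.lookup m 2
        * X 3 ^ Poly_Mapping.lookup m 3"
      unfolding monom_at_def by (rule prod_UNIV_3)
    then show ?thesis
      by (simp only: X e_def monom_power mult_monom power2_eq_square distrib_left mult.assoc
          add.assoc mult_1 power_one)
  qed
  then have "p = (\<Sum>m\<in>Poly_Mapping.keys f. monom (Poly_Mapping.lookup f m) (e m))"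
    by (simp add: p_def insertion_def smult_monom)
  then have "coeff p (e m0) = (\<Sum>m\<in>Poly_Mapping.keys f. if e m = e m0 then Poly_Mapping.lookup f m else 0)"
    by (simp add: coeff_sum)
  \<comment> \<open>Distinct monomials of \<open>f\<close> go to distinct powers of the variable, so
    nothing cancels against \<open>m0\<close>.\<close>
  also have "\<dots> = (\<Sum>m\<in>Poly_Mapping.keys f. if m = m0 then Poly_Mapping.lookup f m else 0)"
    using e_inj by (intro sum.cong) auto
  also have "\<dots> = Poly_Mapping.lookup f m0"
    using m0 by simp
  finally show False
    using \<open>p = 0\<close> m0 by (simp add: in_keys_iff)
qed

subsection \<open>Linear forms and homogeneous polynomials\<close>

lemma linear_form_eq_sum: "linear_form a = (\<Sum>i\<in>UNIV. Poly_Mapping.single 0 (a $ i) * var i)"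
  by (simp add: linear_form_def var_def mult_single)

text \<open>
  Solving \<open>a = 0\<close> for a variable with nonzero coefficient and substituting gives a ring
  endomorphism whose kernel is the ideal of the linear form.
\<close>

lemma linear_form_kernel:
  fixes a :: "'k::field_char_0 ^ 3"
  assumes "a \<noteq> 0"
  shows "\<exists>\<pi> :: 'k poly3 \<Rightarrow> 'k poly3. unital_hom \<pi> \<and>
    (\<forall>f. linear_form a dvd f \<longleftrightarrow> \<pi> f = 0) \<and>
    (\<forall>v f. \<exists>w. dot a w = 0 \<and> eval_at v (\<pi> f) = eval_at w f)"
proof -
  let ?C = "Poly_Mapping.single 0 :: 'k \<Rightarrow> 'k poly3"
  obtain j where j: "a $ j \<noteq> 0"
    using assms by (auto simp: vec_eq_iff)
  define X :: "3 \<Rightarrow> 'k poly3" where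
    "X i = (if i = j then var j - ?C (1 / a $ j) * linear_form a else var i)" for i
  define \<pi> where "\<pi> = insertion ?C X"
  have hom: "unital_hom \<pi>"
    unfolding \<pi>_def by (rule unital_hom.unital_hom_insertion[OF unital_hom_single_0])
  have "\<pi> (linear_form a) = (\<Sum>i\<in>UNIV. ?C (a $ i) * X i)"
    unfolding \<pi>_def by (rule unital_hom.insertion_linear_form[OF unital_hom_single_0])
  also have "\<dots> = (\<Sum>i\<in>UNIV. ?C (a $ i) * var i
      - (if i = j then ?C (a $ j) * (?C (1 / a $ j) * linear_form a) else 0))"
    by (intro sum.cong) (auto simp: X_def algebra_simps)
  also have "\<dots> = linear_form a - ?C (a $ j) * (?C (1 / a $ j) * linear_form a)"
    by (simp add: sum_subtractf linear_form_eq_sum[symmetric])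
  also have "\<dots> = 0"
    using j by (simp add: mult.assoc[symmetric] mult_single)
  finally have \<pi>_a: "\<pi> (linear_form a) = 0" .
  have dvd: "linear_form a dvd f - \<pi> f" for f
  proof -
    have "linear_form a dvd insertion ?C var f - insertion ?C X f"
      by (rule dvd_insertion_diff) (auto simp: X_def)
    then show ?thesis by (simp add: \<pi>_def insertion_var)
  qed
  show ?thesis
  proof (intro exI conjI allI)
    show "linear_form a dvd f \<longleftrightarrow> \<pi> f = 0" for f
    proof
      show "\<pi> f = 0" if "linear_form a dvd f"
        using that \<pi>_a by (auto elim!: dvdE simp: unital_hom.hom_mult[OF hom])
    qed (use dvd[of f] in auto)
    \<comment> \<open>\<open>?w v\<close> is the projection of \<open>v\<close> onto the plane of
      \<open>a\<close> along the \<open>j\<close>-th axis.\<close>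
    let ?w = "\<lambda>v. \<chi> i. eval_at v (X i)"
    show *: "eval_at v (\<pi> f) = eval_at (?w v) f" for v f
      using hom_insertion[OF unital_hom_eval_at[of v], of ?C X f]
      by (simp add: \<pi>_def eval_at_single_0 eval_at_def[of "vec_lambda _"] id_def)
    show "dot a (?w v) = 0" for v
      using *[of v "linear_form a"] by (simp add: \<pi>_a eval_at_linear_form eval_at_hom)
  qed (rule hom)
qed

text \<open>The multiples of the form are the kernel of a homomorphism into an integral
  domain.\<close>

lemma linear_form_prime:
  fixes a :: "'k::field_char_0 ^ 3"
  assumes "a \<noteq> 0" "linear_form a dvd f * g"
  shows "linear_form a dvd f \<or> linear_form a dvd g"
proof -
  obtain \<pi> :: "'k poly3 \<Rightarrow> 'k poly3" where
    "unital_hom \<pi>" "\<And>f. linear_form a dvd f \<longleftrightarrow> \<pi> f = 0"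
    using linear_form_kernel[OF assms(1)] by blast
  then show ?thesis
    using assms(2) by (simp add: unital_hom.hom_mult)
qed

text \<open>Every value of \<open>\<pi> f\<close> is a value of \<open>f\<close> on the plane, so
  \<open>\<pi> f\<close> vanishes everywhere and is therefore zero.\<close>

lemma linear_form_dvdI:
  fixes a :: "'k::field_char_0 ^ 3"
  assumes "a \<noteq> 0" "\<And>v. dot a v = 0 \<Longrightarrow> eval_at v f = 0"
  shows "linear_form a dvd f"
proof -
  obtain \<pi> :: "'k poly3 \<Rightarrow> 'k poly3" where
    \<pi>: "unital_hom \<pi>" "\<And>f. linear_form a dvd f \<longleftrightarrow> \<pi> f = 0"
    "\<And>v f. \<exists>w. dot a w = 0 \<and> eval_at v (\<pi> f) = eval_at w f"
    using linear_form_kernel[OF assms(1)] by metis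
  have "\<pi> f = 0"
  proof (rule eval_at_zero_imp_zero)
    show "eval_at v (\<pi> f) = 0" for v
      using \<pi>(3)[of v f] assms(2) by metis
  qed
  then show ?thesis using \<pi>(2) by simp
qed

lemma lookup_linear_form:
  "Poly_Mapping.lookup (linear_form a) (Poly_Mapping.single i 1) = a $ i"
proof -
  have "Poly_Mapping.lookup (linear_form a) (Poly_Mapping.single i 1)
      = (\<Sum>j\<in>UNIV. if j = i then a $ j else 0)"
    unfolding linear_form_def lookup_sum
    by (intro sum.cong) (auto simp: lookup_single when_def
        dest: arg_cong[where f = "\<lambda>m. Poly_Mapping.lookup m i"])
  then show ?thesis by simp
qed

lemma linear_form_eq_0_iff: "linear_form a = 0 \<longleftrightarrow> a = 0"
proof
  assume "linear_form a = 0"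
  then have "a $ i = 0" for i
    using lookup_linear_form[of a i] by simp
  then show "a = 0"
    by (simp add: vec_eq_iff)
qed (simp add: linear_form_def)

section \<open>Homogeneous polynomials\<close>

lemma homogeneous_0: "homogeneous d 0"
  by (simp add: homogeneous_def)

lemma homogeneous_add: "homogeneous d f \<Longrightarrow> homogeneous d g \<Longrightarrow> homogeneous d (f + g)"
  using Poly_Mapping.keys_add[of f g] by (auto simp: homogeneous_def)

lemma homogeneous_uminus: "homogeneous d f \<Longrightarrow> homogeneous d (- f)"
  for f :: "'k::ab_group_add poly3"
  by (simp add: homogeneous_def)

lemma homogeneous_diff: "homogeneous d f \<Longrightarrow> homogeneous d g \<Longrightarrow> homogeneous d (f - g)"
  for f :: "'k::ab_group_add poly3"
  using homogeneous_add[of d f "- g"] by (simp add: homogeneous_uminus)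

lemma homogeneous_sum: "(\<And>x. x \<in> A \<Longrightarrow> homogeneous d (f x)) \<Longrightarrow> homogeneous d (sum f A)"
  by (induction A rule: infinite_finite_induct) (auto simp: homogeneous_0 homogeneous_add)

lemma homogeneous_mult:
  assumes "homogeneous d f" "homogeneous e g"
  shows "homogeneous (d + e) (f * g)"
  unfolding homogeneous_def
proof
  fix m assume "m \<in> Poly_Mapping.keys (f * g)"
  then obtain a b where "m = a + b" "a \<in> Poly_Mapping.keys f" "b \<in> Poly_Mapping.keys g"
    using Poly_Mapping.keys_mult[of f g] by auto
  then show "(\<Sum>i\<in>UNIV. Poly_Mapping.lookup m i) = d + e"
    using assms by (simp add: homogeneous_def lookup_add sum.distrib)
qed

lemma homogeneous_single: "homogeneous (\<Sum>i\<in>UNIV. Poly_Mapping.lookup m i) (Poly_Mapping.single m c)"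
  by (simp add: homogeneous_def)

lemma sum_lookup_single: "(\<Sum>j\<in>UNIV. Poly_Mapping.lookup (Poly_Mapping.single i n) j) = n"
  for i :: "'x::finite"
  by (simp add: lookup_single when_def)

lemma homogeneous_const: "homogeneous 0 (Poly_Mapping.single 0 c)"
  using homogeneous_single[of 0 c] by simp

lemma homogeneous_1: "homogeneous 0 (1 :: 'k::zero_neq_one poly3)"
  unfolding single_one[symmetric] by (rule homogeneous_const)

lemma homogeneous_var: "homogeneous 1 (var i)"
  using homogeneous_single[of "Poly_Mapping.single i 1" 1] unfolding sum_lookup_single var_def .

lemma homogeneous_linear_form: "homogeneous 1 (linear_form a)"
  for a :: "'k::comm_ring_1 ^ 3"
  unfolding linear_form_eq_sum
  using homogeneous_mult[OF homogeneous_const homogeneous_var, unfolded add_0]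
  by (intro homogeneous_sum)

lemma homogeneous_0_imp_const:
  "homogeneous 0 f \<Longrightarrow> f = Poly_Mapping.single 0 (Poly_Mapping.lookup f 0)"
proof (rule poly_mapping_eqI)
  fix m
  assume "homogeneous 0 f"
  then have "m = 0" if "m \<in> Poly_Mapping.keys f"
    using that by (intro poly_mapping_eqI) (simp add: homogeneous_def)
  then show "Poly_Mapping.lookup f m
      = Poly_Mapping.lookup (Poly_Mapping.single 0 (Poly_Mapping.lookup f 0)) m"
    by (cases "m = 0") (auto simp: lookup_single when_def in_keys_iff)
qed

lemma homogeneous_split:
  fixes f :: "'k::ab_group_add poly3"
  obtains g h where "f = g + h" "homogeneous d g"
    "\<And>m. m \<in> Poly_Mapping.keys h \<Longrightarrow> (\<Sum>i\<in>UNIV. Poly_Mapping.lookup m i) \<noteq> d"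
proof
  let ?K = "Poly_Mapping.keys f" and ?s = "\<lambda>m. \<Sum>i\<in>UNIV. Poly_Mapping.lookup m i"
    and ?f = "\<lambda>m. Poly_Mapping.single m (Poly_Mapping.lookup f m)"
  let ?h = "\<Sum>m\<in>{m \<in> ?K. ?s m \<noteq> d}. ?f m"
  have "f = (\<Sum>m\<in>?K. ?f m)"
    by (rule poly_mapping_eq_sum_single) auto
  also have "\<dots> = (\<Sum>m\<in>{m \<in> ?K. ?s m = d} \<union> {m \<in> ?K. ?s m \<noteq> d}. ?f m)"
    by (rule sum.cong) auto
  finally show "f = (\<Sum>m\<in>{m \<in> ?K. ?s m = d}. ?f m) + ?h"
    by (subst (asm) sum.union_disjoint) auto
  show "homogeneous d (\<Sum>m\<in>{m \<in> ?K. ?s m = d}. ?f m)"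
    using homogeneous_single by (intro homogeneous_sum) auto
  show "?s m \<noteq> d" if "m \<in> Poly_Mapping.keys ?h" for m
    using that Poly_Mapping.keys_sum[of ?f "{m \<in> ?K. ?s m \<noteq> d}"]
    by (auto split: if_splits)
qed

text \<open>Split off the part of \<open>f\<close> of degree \<open>d - 1\<close>. The form times
  the rest is homogeneous of degree \<open>d\<close> but has no monomial of that degree, so it is
  zero and the form cancels. Subtraction is truncated, hence the separate claim for
  \<open>d = 0\<close>.\<close>

lemma homogeneous_quotient:
  fixes f :: "'k::{comm_ring_1, ring_no_zero_divisors} poly3"
  assumes "homogeneous d (linear_form a * f)" "linear_form a \<noteq> 0"
  shows "homogeneous (d - 1) f" "d = 0 \<Longrightarrow> f = 0"
proof -
  \<comment> \<open>With \<open>Suc\<close> on the left the condition holds for every monomial when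
    \<open>d = 0\<close>, so this fact covers that case as well.\<close>
  have *: "h = 0" if h: "homogeneous d (linear_form a * h)"
    and "\<And>m. m \<in> Poly_Mapping.keys h \<Longrightarrow> Suc (\<Sum>i\<in>UNIV. Poly_Mapping.lookup m i) \<noteq> d" for h
  proof -
    have "m \<notin> Poly_Mapping.keys (linear_form a * h)" for m
    proof
      assume m: "m \<in> Poly_Mapping.keys (linear_form a * h)"
      then obtain k l where "m = k + l" "k \<in> Poly_Mapping.keys (linear_form a)"
          "l \<in> Poly_Mapping.keys h"
        using Poly_Mapping.keys_mult[of "linear_form a" h] by auto
      then show False
        using h that(2)[of l] m homogeneous_linear_form[of a]
        by (auto simp: homogeneous_def lookup_add sum.distrib)
    qed
    then have "Poly_Mapping.keys (linear_form a * h) = {}" by blast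
    then show ?thesis using assms(2) by (simp add: keys_eq_empty)
  qed
  show z: "f = 0" if "d = 0"
    using assms that by (intro *) auto
  obtain g h where gh: "f = g + h" "homogeneous (d - 1) g"
    "\<And>m. m \<in> Poly_Mapping.keys h \<Longrightarrow> (\<Sum>i\<in>UNIV. Poly_Mapping.lookup m i) \<noteq> d - 1"
    using homogeneous_split[of f "d - 1"] by metis
  show "homogeneous (d - 1) f"
  proof (cases "d = 0")
    case False
    have "homogeneous d (linear_form a * g)"
      using homogeneous_mult[OF homogeneous_linear_form gh(2), of a] False by simp
    then have "homogeneous d (linear_form a * h)"
      using homogeneous_diff[OF assms(1)] by (fastforce simp: gh(1) distrib_left)
    then have "h = 0"
    proof (rule *)
      fix m assume "m \<in> Poly_Mapping.keys h"
      then show "Suc (\<Sum>i\<in>UNIV. Poly_Mapping.lookup m i) \<noteq> d"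
        using gh(3)[of m] by linarith
    qed
    then show ?thesis using gh by simp
  qed (use z in \<open>simp add: homogeneous_0\<close>)
qed

subsection \<open>Derivations\<close>

lemma partial_deriv_linear_form: "partial_deriv i (linear_form a) = Poly_Mapping.single 0 (a $ i)"
proof -
  let ?s = "\<lambda>j. Poly_Mapping.single j (1::nat) :: 3 \<Rightarrow>\<^sub>0 nat" and ?f = "linear_form a"
  let ?t = "\<lambda>m. Poly_Mapping.single (m - ?s i)
    (of_nat (Poly_Mapping.lookup m i) * Poly_Mapping.lookup ?f m)"
  have inj: "inj ?s"
    by (rule injI) (auto dest: arg_cong[where f = Poly_Mapping.keys])
  have "Poly_Mapping.keys ?f \<subseteq> range ?s"
  proof
    fix m assume "m \<in> Poly_Mapping.keys ?f"
    then have "(\<Sum>j\<in>UNIV. Poly_Mapping.lookup (Poly_Mapping.single (?s j) (a $ j)) m) \<noteq> 0"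
      by (simp add: in_keys_iff linear_form_def lookup_sum)
    then obtain j where "Poly_Mapping.lookup (Poly_Mapping.single (?s j) (a $ j)) m \<noteq> 0"
      by (meson sum.neutral)
    then show "m \<in> range ?s"
      by (auto simp: lookup_single when_def split: if_splits)
  qed
  then have "partial_deriv i ?f = (\<Sum>m\<in>range ?s. ?t m)"
    unfolding partial_deriv_def by (intro sum.mono_neutral_left) (auto simp: in_keys_iff)
  also have "\<dots> = (\<Sum>j\<in>UNIV. ?t (?s j))"
    using sum.reindex[OF inj] by simp
  also have "\<dots> = (\<Sum>j\<in>UNIV. if j = i then Poly_Mapping.single 0 (a $ i) else 0)"
    unfolding lookup_linear_form by (intro sum.cong) (auto simp: lookup_single when_def)
  finally show ?thesis by simp
qed

lemma der_apply_linear_form: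
  "der_apply \<theta> (linear_form a) = (\<Sum>i\<in>UNIV. \<theta> $ i * Poly_Mapping.single 0 (a $ i))"
  by (simp add: der_apply_def partial_deriv_linear_form)

text \<open>Reads the derivation as a polynomial vector field. By \<open>eval_at_der_apply\<close>,
  one that kills the form of a line \<open>H\<close> takes all its values in the plane
  \<open>H\<close>.\<close>

definition eval_der :: "'k::comm_ring_1 deriv3 \<Rightarrow> 'k ^ 3 \<Rightarrow> 'k ^ 3" where
  "eval_der \<theta> v = (\<chi> i. eval_at v (\<theta> $ i))"

lemma eval_at_der_apply: "eval_at v (der_apply \<theta> (linear_form a)) = dot a (eval_der \<theta> v)"
  by (simp add: der_apply_linear_form eval_at_hom eval_at_single_0 dot_def eval_der_def
      mult.commute)

lemma homogeneous_der_apply: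
  fixes a :: "'k::comm_ring_1 ^ 3"
  assumes "\<And>i. homogeneous d (\<theta> $ i)"
  shows "homogeneous d (der_apply \<theta> (linear_form a))"
  unfolding der_apply_linear_form
  using homogeneous_mult[OF assms homogeneous_const, unfolded add_0_right]
  by (intro homogeneous_sum)

text \<open>The Euler derivation, with coefficients \<open>var i\<close>, returns every linear form
  unchanged.\<close>

lemma der_apply_diff_euler:
  "der_apply (\<chi> i. \<theta> $ i - g * var i) (linear_form a)
    = der_apply \<theta> (linear_form a) - g * linear_form a"
  for a :: "'k::comm_ring_1 ^ 3"
proof -
  have "der_apply (\<chi> i. \<theta> $ i - g * var i) (linear_form a)
      = der_apply \<theta> (linear_form a) - g * (\<Sum>i\<in>UNIV. Poly_Mapping.single 0 (a $ i) * var i)"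
    unfolding der_apply_linear_form
    by (simp add: algebra_simps sum_subtractf sum_distrib_left)
  then show ?thesis by (simp add: linear_form_eq_sum)
qed

lemma der_apply_mult:
  "der_apply (\<chi> i. g * \<theta> $ i) (linear_form a) = g * der_apply \<theta> (linear_form a)"
  for a :: "'k::comm_ring_1 ^ 3"
  by (simp add: der_apply_linear_form sum_distrib_left mult.assoc)

section \<open>Vanishing of polynomials in one variable\<close>

text \<open>Stands in for a continuity argument: what is proved for nonzero parameters extends to 0,
  because the field is infinite.\<close>

lemma poly_eq_0_offI:
  fixes p :: "'k::field_char_0 poly"
  assumes "\<And>s. s \<noteq> 0 \<Longrightarrow> poly p s = 0"
  shows "p = 0"
proof (rule ccontr)
  assume "p \<noteq> 0"
  then have "finite {s. poly p s = 0}"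
    by (rule poly_roots_finite)
  then have "finite (UNIV :: 'k set)"
    using assms finite_subset[of "UNIV - {0}" "{s. poly p s = 0}"] by auto
  then show False
    by (simp add: infinite_UNIV_char_0)
qed

lemma poly_eq_0_many_roots:
  fixes p :: "'k::idom poly"
  assumes "degree p < card W" "\<And>t. t \<in> W \<Longrightarrow> poly p t = 0"
  shows "p = 0"
proof (rule ccontr)
  assume "p \<noteq> 0"
  then have "card W \<le> card {t. poly p t = 0}"
    using assms(2) by (intro card_mono poly_roots_finite) auto
  then show False
    using card_poly_roots_bound[OF \<open>p \<noteq> 0\<close>] assms(1) by simp
qed

text \<open>The terms of degree \<open>Suc r\<close> in \<open>F\<close> and in \<open>t G\<close>
  cancel, which keeps the bound at \<open>r\<close> and lets more than \<open>r\<close> roots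
  suffice.\<close>

lemma degree_linear_comb_le:
  fixes F G :: "'k::comm_ring_1 poly"
  assumes "degree F \<le> Suc r" "degree G \<le> r" "coeff F (Suc r) = coeff G r"
  shows "degree (F - [:0, 1:] * G) \<le> r"
proof (rule degree_le, intro allI impI)
  fix i assume "r < i"
  then obtain j where j: "i = Suc j" "r \<le> j"
    by (cases i) auto
  show "coeff (F - [:0, 1:] * G) i = 0"
    using assms j by (cases "j = r") (auto simp: coeff_eq_0)
qed

text \<open>The derivative condition comes first: \<open>F' - t G'\<close> has degree at most
  \<open>r\<close>, hence is zero. Its coefficient of degree \<open>r\<close> is \<open>- r\<close>
  times that of \<open>G\<close>, so in characteristic zero the latter vanishes. Then
  \<open>F - t G\<close> also has degree at most \<open>r\<close> and is zero.\<close>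

lemma tangent_pencil_zero:
  fixes F G :: "'k::field_char_0 poly"
  assumes "r \<ge> 1" "degree F \<le> r" "degree G \<le> r" "card W > r"
    and "\<And>t. t \<in> W \<Longrightarrow> poly F t = t * poly G t"
    and "\<And>t. t \<in> W \<Longrightarrow> poly (pderiv F) t = t * poly (pderiv G) t"
  shows "F = 0" "G = 0"
proof -
  have coeff_pd: "coeff (pderiv H) r = 0" if "degree H \<le> r" for H :: "'k poly"
    using that by (simp add: coeff_pderiv coeff_eq_0)
  have 1: "pderiv F - [:0, 1:] * pderiv G = 0"
  proof (rule poly_eq_0_many_roots)
    have "degree (pderiv F - [:0, 1:] * pderiv G) \<le> r"
      using assms(1-3) coeff_pd[OF assms(3)]
      by (intro degree_linear_comb_le) (auto simp: degree_pderiv coeff_eq_0)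
    then show "degree (pderiv F - [:0, 1:] * pderiv G) < card W"
      using assms(4) by simp
  qed (use assms(6) in simp)
  have "coeff G r = 0"
  proof -
    obtain r' where r': "r = Suc r'"
      using assms(1) by (cases r) auto
    have "coeff (pderiv F - [:0, 1:] * pderiv G) r = 0"
      unfolding 1 by simp
    then have "of_nat r * coeff G r = 0"
      using coeff_pd[OF assms(2)] r' by (simp add: coeff_pderiv)
    then show ?thesis using assms(1) mult_eq_0_iff of_nat_eq_0_iff not_one_le_zero by metis
  qed
  have 2: "F - [:0, 1:] * G = 0"
  proof (rule poly_eq_0_many_roots)
    have "degree (F - [:0, 1:] * G) \<le> r"
      using assms(2,3) \<open>coeff G r = 0\<close> by (intro degree_linear_comb_le) (auto simp: coeff_eq_0)
    then show "degree (F - [:0, 1:] * G) < card W"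
      using assms(4) by simp
  qed (use assms(5) in simp)
  then have F: "F = [:0, 1:] * G" by simp
  show "G = 0"
    \<comment> \<open>Differentiating \<open>F = t G\<close> gives \<open>F' = G + t G'\<close>, and
      \<open>F' = t G'\<close> is known.\<close>
    using 1 unfolding F by (simp add: pderiv_mult pderiv_pCons)
  then show "F = 0" using F by simp
qed

text \<open>The forms of \<open>c\<close> and \<open>d\<close> extend the dual basis of
  \<open>v1, v2\<close> from the plane to the whole space. As constant vectors they also extract the
  coordinates of a polynomial vector field.\<close>

lemma plane_coordinates:
  fixes H :: "('k::field ^ 'n) set"
  assumes "vec.subspace H" "vec.dim H = 2" "v1 \<in> H" "v1 \<noteq> 0"
  obtains v2 c d where "v2 \<in> H"
    "dot c v1 = 1" "dot c v2 = 0" "dot d v1 = 0" "dot d v2 = 1"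
    "\<And>x. x \<in> H \<Longrightarrow> x = dot c x *s v1 + dot d x *s v2"
proof -
  have "vec.independent {v1}"
    using assms(4) by simp
  then obtain B where B: "{v1} \<subseteq> B" "B \<subseteq> H" "vec.independent B" "H \<subseteq> vec.span B"
    using vec.maximal_independent_subset_extend[of "{v1}" H] assms(3) by auto
  have "card B = 2"
    using B assms(2) vec.basis_card_eq_dim by metis
  then obtain v2 where v2: "B = {v1, v2}" "v1 \<noteq> v2"
    using B(1) by (auto simp: card_2_iff)
  \<comment> \<open>A functional with prescribed values on the basis is taken as a map into
    \<open>'k ^ 1\<close>; the single row of its matrix is the vector sought.\<close>
  have ext: "\<exists>e. dot e v1 = a \<and> dot e v2 = b" for a b
  proof -
    obtain g :: "'k ^ 'n \<Rightarrow> 'k ^ 1" where g: "Vector_Spaces.linear (*s) (*s) g"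
      "\<forall>x\<in>B. g x = (if x = v1 then vec a else vec b)"
      using vec.linear_independent_extend[OF B(3), of "\<lambda>x. if x = v1 then vec a else vec b"]
      by blast
    have "dot (matrix g $ 1) x = g x $ 1" for x
      using matrix_works[OF g(1), of x] by (simp add: dot_def matrix_vector_mult_def vec_eq_iff)
    then show ?thesis
      using g(2) v2 by (intro exI[of _ "matrix g $ 1"]) auto
  qed
  obtain c d where cd: "dot c v1 = 1" "dot c v2 = 0" "dot d v1 = 0" "dot d v2 = 1"
    using ext by metis
  show thesis
  proof
    fix x assume "x \<in> H"
    then have "x \<in> vec.span {v1, v2}"
      using B v2 by auto
    then obtain a b where "x - a *s v1 - b *s v2 = 0"
      by (auto simp: vec.span_breakdown_eq)
    then have x: "x = a *s v1 + b *s v2"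
      by (simp add: algebra_simps)
    show "x = dot c x *s v1 + dot d x *s v2"
      unfolding x by (simp add: dot_add dot_mult cd)
  qed (use B v2 cd in auto)
qed

subsection \<open>Line arrangements\<close>

locale arrangement =
  fixes \<A> :: "('k::field_char_0 ^ 3) set set" and \<alpha> :: "('k ^ 3) set \<Rightarrow> 'k ^ 3"
  assumes arrangement: "line_arrangement \<A> \<alpha>"
begin

lemma finite_lines: "finite \<A>"
  using arrangement by (simp add: line_arrangement_def)

lemma subspace_line: "L \<in> \<A> \<Longrightarrow> vec.subspace L"
  and dim_line: "L \<in> \<A> \<Longrightarrow> vec.dim L = 2"
  using arrangement by (auto simp: line_arrangement_def proj_line_def)

lemma mem_line: "L \<in> \<A> \<Longrightarrow> v \<in> L \<longleftrightarrow> dot (\<alpha> L) v = 0"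
  using arrangement unfolding line_arrangement_def dot_def by blast

lemma not_concurrent: "proj_point p \<Longrightarrow> \<exists>L\<in>\<A>. \<not> p \<subseteq> L"
  using arrangement by (auto simp: line_arrangement_def)

lemma alpha_nonzero:
  assumes "L \<in> \<A>"
  shows "\<alpha> L \<noteq> 0"
proof
  assume "\<alpha> L = 0"
  then have "L = UNIV"
    using mem_line[OF assms] by (auto simp: dot_def)
  then show False
    using dim_line[OF assms] by (simp only: vec_dim_card) simp
qed

lemma linear_form_alpha_nonzero: "L \<in> \<A> \<Longrightarrow> linear_form (\<alpha> L) \<noteq> 0"
  by (simp add: linear_form_eq_0_iff alpha_nonzero)

lemma line_not_subset:
  assumes "L \<in> \<A>" "L' \<in> \<A>" "L \<noteq> L'"
  shows "\<exists>w\<in>L. w \<notin> L'"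
proof (rule ccontr)
  assume "\<not> ?thesis"
  then have "L \<subseteq> L'" by blast
  then have "L = L'"
    using assms by (intro vec.subspace_dim_equal) (auto simp: subspace_line dim_line)
  then show False using assms by simp
qed

lemma line_nonzero:
  assumes "L \<in> \<A>"
  obtains u where "u \<in> L" "u \<noteq> 0"
proof -
  have "\<not> L \<subseteq> {0}"
    using dim_line[OF assms] vec.dim_le_card[of L "{}"] by auto
  then show thesis using that by blast
qed

section \<open>Derivations of given degree killing a line\<close>

text \<open>Nonzero elements are singled out so that \<open>mdr\<close> becomes the least
  \<open>d\<close> for which some \<open>\<theta>\<close> satisfies this.\<close>

definition has_der :: "nat \<Rightarrow> ('k ^ 3) set \<Rightarrow> 'k deriv3 \<Rightarrow> bool" where
  "has_der d L \<theta> \<longleftrightarrow> \<theta> \<noteq> 0 \<and> \<theta> \<in> graded_part d (log_derivations_at \<A> \<alpha> L)"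

lemma has_der_iff:
  "has_der d L \<theta> \<longleftrightarrow> \<theta> \<noteq> 0 \<and> (\<forall>i. homogeneous d (\<theta> $ i)) \<and>
    der_apply \<theta> (linear_form (\<alpha> L)) = 0 \<and>
    (\<forall>K\<in>\<A>. linear_form (\<alpha> K) dvd der_apply \<theta> (linear_form (\<alpha> K)))"
  by (auto simp: has_der_def graded_part_def log_derivations_at_def log_derivations_def)

text \<open>
  Subtracting a multiple of the Euler derivation, which is logarithmic for every arrangement,
  moves a derivation killing one line to a derivation killing another.
\<close>

lemma has_der_transfer:
  assumes "L \<in> \<A>" "H \<in> \<A>" "has_der d L \<theta>"
  shows "\<exists>\<theta>'. has_der d H \<theta>'"
proof -
  let ?l = "\<lambda>K. linear_form (\<alpha> K)"
  have hom: "\<And>i. homogeneous d (\<theta> $ i)"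
    using assms(3) by (simp add: has_der_iff)
  have "?l H dvd der_apply \<theta> (?l H)"
    using assms(2,3) by (simp add: has_der_iff)
  then obtain g where g: "der_apply \<theta> (?l H) = ?l H * g"
    by (rule dvdE)
  then have "homogeneous d (?l H * g)"
    using homogeneous_der_apply[OF hom] by metis
  note g_hom = homogeneous_quotient[OF this linear_form_alpha_nonzero[OF assms(2)]]
  have gx: "homogeneous d (g * var i)" for i
  proof (cases "d = 0")
    case False
    then show ?thesis
      using homogeneous_mult[OF g_hom(1) homogeneous_var, of i] by simp
  qed (simp add: g_hom(2) homogeneous_0)
  define \<theta>' where "\<theta>' = (\<chi> i. \<theta> $ i - g * var i)"
  have der: "der_apply \<theta>' (linear_form a) = der_apply \<theta> (linear_form a) - g * linear_form a" for a
    unfolding \<theta>'_def by (rule der_apply_diff_euler)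
  have "\<theta>' \<noteq> 0"
  proof
    assume "\<theta>' = 0"
    then have "g * ?l L = 0"
      using der[of "\<alpha> L"] assms(3) by (simp add: has_der_iff der_apply_def)
    then have "g = 0"
      using linear_form_alpha_nonzero[OF assms(1)] by simp
    then have "\<theta>' = \<theta>"
      by (simp add: \<theta>'_def vec_eq_iff)
    then show False
      using \<open>\<theta>' = 0\<close> assms(3) by (simp add: has_der_iff)
  qed
  moreover have "homogeneous d (\<theta>' $ i)" for i
    using homogeneous_diff[OF hom gx] by (simp add: \<theta>'_def)
  moreover have "der_apply \<theta>' (?l H) = 0"
    by (simp add: der g mult.commute)
  moreover have "?l K dvd der_apply \<theta>' (?l K)" if "K \<in> \<A>" for K
    using assms(3) that by (simp add: der has_der_iff)
  ultimately show ?thesis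
    by (auto simp: has_der_iff)
qed

text \<open>The product \<open>Q\<close> of all the forms times a constant field \<open>u\<close> in
  \<open>L\<close>: each form divides \<open>Q\<close>, and the form of \<open>L\<close> vanishes at
  \<open>u\<close>. Thus the minimum in \<open>mdr\<close> is attained.\<close>

lemma has_der_exists:
  assumes "L \<in> \<A>"
  shows "\<exists>d \<theta>. has_der d L \<theta>"
proof -
  obtain u where u: "u \<in> L" "u \<noteq> 0"
    using line_nonzero[OF assms] by metis
  define Q where "Q = (\<Prod>K\<in>\<A>. linear_form (\<alpha> K))"
  have hom: "homogeneous (card S) (\<Prod>K\<in>S. linear_form (\<alpha> K))" if "finite S" for S
    using that
  proof induction
    case empty
    show ?case by (simp add: homogeneous_1)
  next
    case (insert K S)
    then show ?case using homogeneous_mult[OF homogeneous_linear_form] by fastforce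
  qed
  define \<theta> where "\<theta> = (\<chi> i. Q * Poly_Mapping.single 0 (u $ i))"
  have der: "der_apply \<theta> (linear_form a) = Q * Poly_Mapping.single 0 (dot a u)" for a
  proof -
    have "der_apply \<theta> (linear_form a) = Q * (\<Sum>i\<in>UNIV. Poly_Mapping.single 0 (a $ i * u $ i))"
      by (simp add: \<theta>_def der_apply_linear_form sum_distrib_left mult.assoc mult_single)
        (simp add: mult.commute)
    then show ?thesis
      by (simp add: dot_def unital_hom.hom_sum[OF unital_hom_single_0])
  qed
  have "Q \<noteq> 0"
    unfolding Q_def using finite_lines linear_form_alpha_nonzero by simp
  moreover obtain i where "u $ i \<noteq> 0"
    using u by (auto simp: vec_eq_iff)
  ultimately have "\<theta> $ i \<noteq> 0"
    by (simp add: \<theta>_def single_eq_0_iff)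
  then have "\<theta> \<noteq> 0" by auto
  moreover have "homogeneous (card \<A>) (\<theta> $ i)" for i
    using homogeneous_mult[OF hom[OF finite_lines] homogeneous_const] by (simp add: \<theta>_def Q_def)
  moreover have "der_apply \<theta> (linear_form (\<alpha> L)) = 0"
    using mem_line[OF assms] u by (simp add: der)
  moreover have "linear_form (\<alpha> K) dvd Q" if "K \<in> \<A>" for K
    unfolding Q_def using that finite_lines by (rule dvd_prodI[rotated])
  ultimately have "has_der (card \<A>) L \<theta>"
    by (auto simp: has_der_iff der)
  then show ?thesis by blast
qed

text \<open>Transfer in both directions replaces the line fixed in \<open>mdr\<close> by the line
  \<open>H\<close> under study.\<close>

lemma mdr_eq:
  assumes "L \<in> \<A>" "H \<in> \<A>"
  shows "\<exists>\<theta>. has_der (mdr \<A> \<alpha> L) H \<theta>" "d < mdr \<A> \<alpha> L \<Longrightarrow> \<not> has_der d H \<theta>"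
proof -
  have "0 \<in> graded_part d (log_derivations_at \<A> \<alpha> L)" for d
    by (auto simp: graded_part_def log_derivations_at_def log_derivations_def der_apply_def
        homogeneous_0)
  then have "graded_part d (log_derivations_at \<A> \<alpha> L) \<noteq> {0} \<longleftrightarrow> (\<exists>\<theta>. has_der d L \<theta>)" for d
    by (auto simp: has_der_def)
  then have mdr: "mdr \<A> \<alpha> L = (LEAST d. \<exists>\<theta>. has_der d L \<theta>)"
    by (simp only: mdr_def)
  have "\<exists>\<theta>. has_der (mdr \<A> \<alpha> L) L \<theta>"
    unfolding mdr by (rule LeastI_ex) (rule has_der_exists[OF assms(1)])
  then show "\<exists>\<theta>. has_der (mdr \<A> \<alpha> L) H \<theta>"
    using has_der_transfer[OF assms] by blast
  show "\<not> has_der d H \<theta>" if "d < mdr \<A> \<alpha> L"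
    using not_less_Least[of d "\<lambda>d. \<exists>\<theta>. has_der d L \<theta>"] that has_der_transfer[OF assms(2,1)]
    unfolding mdr by blast
qed

text \<open>A logarithmic derivation with constant coefficients is a point common to all lines.\<close>

lemma has_der_degree_pos:
  assumes "has_der d H \<theta>"
  shows "d \<ge> 1"
proof (rule ccontr)
  assume "\<not> d \<ge> 1"
  then have "d = 0" by simp
  then have "homogeneous 0 (\<theta> $ i)" for i
    using assms by (simp add: has_der_iff)
  note const = homogeneous_0_imp_const[OF this]
  define u where "u = (\<chi> i. Poly_Mapping.lookup (\<theta> $ i) 0)"
  have \<theta>: "\<theta> = (\<chi> i. Poly_Mapping.single 0 (u $ i))"
    unfolding vec_eq_iff using const by (simp add: u_def)
  then have "u \<noteq> 0"
    using assms by (auto simp: has_der_iff vec_eq_iff single_eq_0_iff)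
  have eval: "eval_der \<theta> 0 = u"
    unfolding \<theta> by (simp add: eval_der_def eval_at_single_0)
  have "proj_point (vec.span {u})"
    using \<open>u \<noteq> 0\<close> by (simp add: proj_point_def vec.dim_span vec.dim_eq_card_independent)
  then obtain L where L: "L \<in> \<A>" "\<not> vec.span {u} \<subseteq> L"
    using not_concurrent by blast
  have "linear_form (\<alpha> L) dvd der_apply \<theta> (linear_form (\<alpha> L))"
    using assms L(1) by (simp add: has_der_iff)
  then obtain g where "der_apply \<theta> (linear_form (\<alpha> L)) = linear_form (\<alpha> L) * g"
    by (rule dvdE)
  \<comment> \<open>Evaluate at the origin, where the linear form on the right vanishes.\<close>
  then have "dot (\<alpha> L) u = 0"
    unfolding eval[symmetric] eval_at_der_apply[symmetric] by (simp add: eval_at_hom eval_at_linear_form dot_zero)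
  then have "u \<in> L"
    using mem_line L(1) by simp
  then show False
    using L vec.span_minimal[of "{u}" L] subspace_line by simp
qed

text \<open>Otherwise \<open>\<theta> / \<alpha>\<^sub>H\<close> would be a derivation of smaller degree.\<close>

lemma has_der_not_vanishing:
  assumes H: "H \<in> \<A>" and \<theta>: "has_der r H \<theta>" and min: "\<And>d \<theta>'. d < r \<Longrightarrow> \<not> has_der d H \<theta>'"
  shows "\<exists>x\<in>H. eval_der \<theta> x \<noteq> 0"
proof (rule ccontr)
  let ?l = "\<lambda>K. linear_form (\<alpha> K)"
  assume "\<not> ?thesis"
  then have "?l H dvd \<theta> $ i" for i
    using H by (intro linear_form_dvdI alpha_nonzero) (auto simp: mem_line eval_der_def vec_eq_iff)
  then obtain \<eta>' where \<eta>': "\<And>i. \<theta> $ i = ?l H * \<eta>' i"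
    unfolding dvd_def by metis
  define \<eta> where "\<eta> = vec_lambda \<eta>'"
  have \<eta>: "\<theta> = (\<chi> i. ?l H * \<eta> $ i)"
    by (simp add: \<eta>_def \<eta>' vec_eq_iff)
  have der: "der_apply \<theta> (linear_form a) = ?l H * der_apply \<eta> (linear_form a)" for a
    unfolding \<eta> by (rule der_apply_mult)
  have "\<eta> \<noteq> 0"
    using \<theta> by (auto simp: \<eta> has_der_iff vec_eq_iff)
  moreover have "homogeneous (r - 1) (\<eta> $ i)" for i
    using \<theta> H linear_form_alpha_nonzero
    by (intro homogeneous_quotient(1)[of r "\<alpha> H"]) (auto simp: \<eta> has_der_iff)
  moreover have "der_apply \<eta> (?l H) = 0"
    using \<theta> H der[of "\<alpha> H"] linear_form_alpha_nonzero by (auto simp: has_der_iff)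
  moreover have "?l K dvd der_apply \<eta> (?l K)" if K: "K \<in> \<A>" for K
  proof (cases "K = H")
    case False
    then obtain w where w: "w \<in> K" "w \<notin> H"
      using line_not_subset K H by blast
    \<comment> \<open>At \<open>w\<close> the form of \<open>K\<close> vanishes and that of
      \<open>H\<close> does not. Primality then forces \<open>?l K\<close> to divide the other
      factor.\<close>
    have "\<not> ?l K dvd ?l H"
    proof
      assume "?l K dvd ?l H"
      then obtain g where "?l H = ?l K * g" by (rule dvdE)
      then have "eval_at w (?l H) = eval_at w (?l K) * eval_at w g"
        by (simp add: eval_at_hom)
      then show False
        using w K H by (simp add: mem_line eval_at_linear_form)
    qed
    moreover have "?l K dvd ?l H * der_apply \<eta> (?l K)"
      using \<theta> K der[of "\<alpha> K"] by (auto simp: has_der_iff)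
    ultimately show ?thesis
      using linear_form_prime alpha_nonzero K by blast
  qed (use \<open>der_apply \<eta> (?l H) = 0\<close> in simp)
  ultimately have "has_der (r - 1) H \<eta>"
    by (simp add: has_der_iff)
  \<comment> \<open>As \<open>r \<ge> 1\<close>, the truncated \<open>r - 1\<close> is really below
    \<open>r\<close>.\<close>
  then show False
    using min[of "r - 1"] has_der_degree_pos[OF \<theta>] by force
qed

section \<open>Points on one line of the arrangement\<close>

text \<open>Each other line contains at most one vector \<open>u + s *s v\<close>, so finitely many
  parameters \<open>s\<close> are excluded from an infinite field.\<close>

lemma generic_direction:
  assumes H: "H \<in> \<A>"
  shows "\<exists>v\<in>H. v \<noteq> 0 \<and> (\<forall>L\<in>\<A>. L \<noteq> H \<longrightarrow> v \<notin> L)"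
proof -
  obtain u where u: "u \<in> H" "u \<noteq> 0"
    using line_nonzero[OF H] by metis
  obtain v c d where v: "v \<in> H" "dot c u = 1" "dot c v = 0"
    and gen: "\<And>x. x \<in> H \<Longrightarrow> x = dot c x *s u + dot d x *s v"
    using plane_coordinates[OF subspace_line[OF H] dim_line[OF H] u] by metis
  define S where "S L = {s. u + s *s v \<in> L}" for L
  have "finite (S L)" if L: "L \<in> \<A>" "L \<noteq> H" for L
  proof -
    have "s = s'" if s: "s \<in> S L" "s' \<in> S L" for s s'
    proof (rule ccontr)
      assume "s \<noteq> s'"
      have eq: "dot (\<alpha> L) u + s * dot (\<alpha> L) v = 0" "dot (\<alpha> L) u + s' * dot (\<alpha> L) v = 0"
        using s L by (auto simp: S_def mem_line dot_add dot_mult)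
      have "(s - s') * dot (\<alpha> L) v
          = (dot (\<alpha> L) u + s * dot (\<alpha> L) v) - (dot (\<alpha> L) u + s' * dot (\<alpha> L) v)"
        by (simp add: algebra_simps)
      also have "\<dots> = 0"
        unfolding eq by simp
      finally have "(s - s') * dot (\<alpha> L) v = 0" .
      then have "dot (\<alpha> L) v = 0"
        using \<open>s \<noteq> s'\<close> by simp
      \<comment> \<open>Two parameters in \<open>S L\<close> make the form of \<open>L\<close>
        vanish on a basis of \<open>H\<close>, so \<open>L\<close> would contain
        \<open>H\<close>.\<close>
      then have z: "dot (\<alpha> L) u = 0" "dot (\<alpha> L) v = 0"
        using eq by auto
      obtain w where w: "w \<in> H" "w \<notin> L"
        using line_not_subset[OF H L(1)] L(2) by blast
      have "dot (\<alpha> L) (dot c w *s u + dot d w *s v) = 0"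
        by (simp add: z dot_add dot_mult)
      then show False
        using w L gen[OF w(1)] by (simp add: mem_line)
    qed
    then show ?thesis
      by (metis (full_types) finite.simps is_singletonI' is_singleton_def)
  qed
  then have "finite (\<Union>L\<in>\<A> - {H}. S L)"
    using finite_lines by auto
  then obtain s where s: "s \<notin> (\<Union>L\<in>\<A> - {H}. S L)"
    using ex_new_if_finite infinite_UNIV_char_0 by blast
  have "dot c (u + s *s v) = 1"
    by (simp add: dot_add dot_mult v)
  then have "u + s *s v \<noteq> 0"
    by (auto simp: dot_zero)
  moreover have "u + s *s v \<in> H"
    using u v subspace_line[OF H] by (simp add: vec.subspace_add vec.subspace_scale)
  ultimately show ?thesis
    using s by (auto simp: S_def)
qed

lemma on_another_line:
  assumes "p \<in> intersection_points \<A>"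
  shows "\<exists>L\<in>\<A>. L \<noteq> H \<and> p \<subseteq> L"
proof (rule ccontr)
  assume "\<not> ?thesis"
  then have "lines_through \<A> p \<subseteq> {H}"
    by (auto simp: lines_through_def)
  then have "card (lines_through \<A> p) \<le> 1"
    using card_mono[of "{H}"] by simp
  then show False
    using assms by (simp add: intersection_points_def)
qed

lemma on_two_other_lines:
  assumes "card (lines_through \<A> p) \<ge> 3"
  shows "\<exists>L1\<in>\<A>. \<exists>L2\<in>\<A>. L1 \<noteq> L2 \<and> L1 \<noteq> H \<and> L2 \<noteq> H \<and> p \<subseteq> L1 \<and> p \<subseteq> L2"
proof -
  have "card (lines_through \<A> p - {H}) \<ge> 2"
    using assms diff_card_le_card_Diff[of "{H}" "lines_through \<A> p"] by simp
  then obtain S where S: "S \<subseteq> lines_through \<A> p - {H}" "card S = 2"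
    by (metis obtain_subset_with_card_n)
  then obtain L1 L2 where "S = {L1, L2}" "L1 \<noteq> L2"
    unfolding card_2_iff by blast
  then have "L1 \<in> lines_through \<A> p - {H}" "L2 \<in> lines_through \<A> p - {H}"
    using S(1) by auto
  then show ?thesis
    using \<open>L1 \<noteq> L2\<close> by (intro bexI[of _ L1] bexI[of _ L2]) (auto simp: lines_through_def)
qed

text \<open>
  At a point on three lines the quotient \<open>\<theta>(\<alpha>\<^sub>2) / \<alpha>\<^sub>2\<close> vanishes: it does so along
  the second line \<open>L1\<close>, where \<open>\<theta>\<close> takes values in \<open>H \<inter> L1\<close>.
\<close>

lemma quotient_vanishes:
  assumes lines: "H \<in> \<A>" "L1 \<in> \<A>" "L2 \<in> \<A>" "L1 \<noteq> H" "L1 \<noteq> L2"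
    and q: "q \<in> H" "q \<in> L1" "q \<in> L2" "q \<noteq> 0"
    and \<theta>: "has_der r H \<theta>"
    and \<psi>: "der_apply \<theta> (linear_form (\<alpha> L2)) = linear_form (\<alpha> L2) * \<psi>"
  shows "eval_at q \<psi> = 0"
proof -
  obtain w where w: "w \<in> L1" "w \<notin> L2"
    using line_not_subset lines by blast
  obtain v c d where v: "v \<in> H" and gen: "\<And>x. x \<in> H \<Longrightarrow> x = dot c x *s q + dot d x *s v"
    using plane_coordinates[OF subspace_line dim_line] lines(1) q by metis
  have "v \<notin> L1"
  proof
    assume "v \<in> L1"
    then have "x \<in> L1" if "x \<in> H" for x
      using gen[OF that] q subspace_line[OF lines(2)]
      by (metis vec.subspace_add vec.subspace_scale)
    then show False
      using line_not_subset lines by blast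
  qed
  \<comment> \<open>The line \<open>q + s *s w\<close> runs inside \<open>L1\<close>. The value
    \<open>s = 0\<close> is left out because the form of \<open>L2\<close> vanishes at
    \<open>q\<close> and could not be cancelled.\<close>
  have "poly (along q w \<psi>) s = 0" if "s \<noteq> 0" for s
  proof -
    define x where "x = q + s *s w"
    define y where "y = eval_der \<theta> x"
    have "x \<in> L1"
      using w q subspace_line[OF lines(2)] by (simp add: x_def vec.subspace_add vec.subspace_scale)
    have "dot (\<alpha> H) y = 0"
      using \<theta> by (simp add: y_def eval_at_der_apply[symmetric] has_der_iff eval_at_hom)
    then have y: "y = dot c y *s q + dot d y *s v"
      using gen[of y] lines(1) by (simp add: mem_line)
    have "linear_form (\<alpha> L1) dvd der_apply \<theta> (linear_form (\<alpha> L1))"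
      using \<theta> lines by (simp add: has_der_iff)
    then obtain g where "der_apply \<theta> (linear_form (\<alpha> L1)) = linear_form (\<alpha> L1) * g"
      by (rule dvdE)
    then have "dot (\<alpha> L1) y = dot (\<alpha> L1) x * eval_at x g"
      by (simp add: y_def eval_at_der_apply[symmetric] eval_at_hom eval_at_linear_form)
    also have "\<dots> = 0"
      using \<open>x \<in> L1\<close> lines by (simp add: mem_line)
    finally have "dot (\<alpha> L1) (dot c y *s q + dot d y *s v) = 0"
      using y by simp
    \<comment> \<open>The form of \<open>L1\<close> vanishes at \<open>q\<close> but not at
      \<open>v\<close>, so \<open>y\<close> is a multiple of \<open>q\<close> and therefore lies in
      \<open>L2\<close>.\<close>
    then have "dot d y = 0"
      using \<open>v \<notin> L1\<close> q lines by (simp add: dot_add dot_mult mem_line)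
    then have "dot (\<alpha> L2) y = 0"
      using q lines by (subst y) (simp add: dot_mult mem_line)
    then have "dot (\<alpha> L2) x * eval_at x \<psi> = 0"
      using \<psi> by (simp add: y_def eval_at_der_apply[symmetric] eval_at_hom eval_at_linear_form)
    moreover have "dot (\<alpha> L2) x \<noteq> 0"
      using w q lines that by (simp add: x_def dot_add dot_mult mem_line)
    ultimately show ?thesis
      by (simp add: poly_along x_def)
  qed
  then have "along q w \<psi> = 0"
    by (rule poly_eq_0_offI)
  then have "poly (along q w \<psi>) 0 = 0"
    by simp
  then show ?thesis
    by (simp add: poly_along)
qed

text \<open>Another line through \<open>p\<close> misses \<open>v1\<close>, so a vector spanning
  \<open>p\<close> has nonzero \<open>v2\<close>-coordinate and can be scaled to make it 1.\<close>

lemma restriction_param: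
  assumes H: "H \<in> \<A>" and v1: "v1 \<in> H" "\<And>L. L \<in> \<A> \<Longrightarrow> L \<noteq> H \<Longrightarrow> v1 \<notin> L"
    and gen: "\<And>x. x \<in> H \<Longrightarrow> x = dot c x *s v1 + dot d x *s v2"
    and p: "p \<in> restriction \<A> H"
  shows "\<exists>t. p = vec.span {v2 + t *s v1}"
proof -
  have pt: "vec.subspace p" "vec.dim p = 1" "p \<subseteq> H"
    using p by (auto simp: restriction_def intersection_points_def proj_point_def)
  obtain L where L: "L \<in> \<A>" "L \<noteq> H" "p \<subseteq> L"
    using on_another_line[of p H] p by (auto simp: restriction_def)
  obtain B where B: "B \<subseteq> p" "vec.independent B" "p \<subseteq> vec.span B" "card B = 1"
    using vec.basis_exists[of p] pt by metis
  then obtain x where x: "B = {x}"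
    by (auto simp: card_1_singleton_iff)
  then have "x \<noteq> 0" "x \<in> p" "p = vec.span {x}"
    using B pt vec.span_minimal[of B p] by auto
  have "dot d x \<noteq> 0"
  proof
    assume "dot d x = 0"
    then have "x = dot c x *s v1"
      using gen[of x] \<open>x \<in> p\<close> pt by auto
    then have "dot c x \<noteq> 0" "dot (\<alpha> L) (dot c x *s v1) = 0"
      using \<open>x \<noteq> 0\<close> \<open>x \<in> p\<close> L mem_line by auto
    then show False
      using v1(2) L by (simp add: mem_line dot_mult)
  qed
  define q where "q = v2 + (dot c x / dot d x) *s v1"
  have "x = dot d x *s q"
    using gen[of x] \<open>x \<in> p\<close> pt(3) \<open>dot d x \<noteq> 0\<close>
    by (auto simp: q_def vector_add_ldistrib vector_smult_assoc add.commute)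
  then have "vec.span {x} = vec.span {q}"
    using vec.span_image_scale[of "{q}" "\<lambda>_. dot d x"] \<open>dot d x \<noteq> 0\<close> by auto
  then show ?thesis
    using \<open>p = vec.span {x}\<close> q_def by blast
qed

text \<open>Finiteness: sending a point to another line through it is injective. Bound: more than
  \<open>r\<close> points on three or more lines would make the vector field of
  \<open>\<theta>\<close> vanish on all of \<open>H\<close>.\<close>

lemma multiple_points_le:
  assumes H: "H \<in> \<A>" and \<theta>: "has_der r H \<theta>" and min: "\<And>d \<theta>'. d < r \<Longrightarrow> \<not> has_der d H \<theta>'"
  shows "finite (restriction \<A> H)"
    and "card {p \<in> restriction \<A> H. card (lines_through \<A> p) \<ge> 3} \<le> r"
proof -
  obtain v1 where v1: "v1 \<in> H" "v1 \<noteq> 0" "\<And>L. L \<in> \<A> \<Longrightarrow> L \<noteq> H \<Longrightarrow> v1 \<notin> L"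
    using generic_direction[OF H] by metis
  obtain v2 c d where v2: "v2 \<in> H"
    and cd: "dot c v1 = 1" "dot c v2 = 0" "dot d v1 = 0" "dot d v2 = 1"
    and gen: "\<And>x. x \<in> H \<Longrightarrow> x = dot c x *s v1 + dot d x *s v2"
    using plane_coordinates[OF subspace_line[OF H] dim_line[OF H] v1(1,2)] by metis
  define q where "q t = v2 + t *s v1" for t
  have q: "q t \<in> H" "q t \<noteq> 0" for t
  proof -
    show "q t \<in> H"
      using v1 v2 subspace_line[OF H] by (simp add: q_def vec.subspace_add vec.subspace_scale)
    have "dot d (q t) = 1"
      by (simp add: q_def dot_add dot_mult cd)
    then show "q t \<noteq> 0"
      by (auto simp: dot_zero)
  qed
  obtain T where T: "\<And>p. p \<in> restriction \<A> H \<Longrightarrow> p = vec.span {q (T p)}"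
    using restriction_param[OF H v1(1,3) gen] unfolding q_def by metis
  have T_inj: "inj_on T (restriction \<A> H)"
    using T by (metis inj_onI)
  have q_p: "q (T p) \<in> p" if "p \<in> restriction \<A> H" for p
    using T[OF that] vec.span_base[of "q (T p)" "{q (T p)}"] by blast

  obtain K where K: "\<And>p. p \<in> restriction \<A> H \<Longrightarrow> K p \<in> \<A> \<and> K p \<noteq> H \<and> p \<subseteq> K p"
    using on_another_line[of _ H] by (simp add: restriction_def) metis
  have "inj_on K (restriction \<A> H)"
  proof (rule inj_onI)
    fix p p' assume p: "p \<in> restriction \<A> H" "p' \<in> restriction \<A> H" "K p = K p'"
    then have "q (T p) \<in> K p" "q (T p') \<in> K p"
      using K[of p] K[of p'] q_p[of p] q_p[of p'] by auto
    then have "dot (\<alpha> (K p)) v2 + T p * dot (\<alpha> (K p)) v1 = 0"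
      "dot (\<alpha> (K p)) v2 + T p' * dot (\<alpha> (K p)) v1 = 0"
      using K[OF p(1)] by (auto simp: q_def mem_line dot_add dot_mult)
    then have "T p * dot (\<alpha> (K p)) v1 = T p' * dot (\<alpha> (K p)) v1"
      by (metis add_left_cancel)
    \<comment> \<open>By the choice of \<open>v1\<close> the parameter has nonzero coefficient, so
      \<open>K p\<close> meets the affine line only once.\<close>
    moreover have "dot (\<alpha> (K p)) v1 \<noteq> 0"
      using v1(3) K[OF p(1)] by (simp add: mem_line)
    ultimately have "T p = T p'" by simp
    then show "p = p'"
      using T_inj p by (simp add: inj_on_def)
  qed
  moreover have "K ` restriction \<A> H \<subseteq> \<A>"
    using K by blast
  ultimately show fin: "finite (restriction \<A> H)"
    using finite_lines by (metis finite_imageD finite_subset)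

  define M where "M = {p \<in> restriction \<A> H. card (lines_through \<A> p) \<ge> 3}"
  \<comment> \<open>\<open>F\<close> and \<open>G\<close> are the \<open>v1\<close>- and
    \<open>v2\<close>-coordinates of the vector field along the affine line
    \<open>q\<close>.\<close>
  define F where "F = (\<Sum>i\<in>UNIV. smult (c $ i) (along v2 v1 (\<theta> $ i)))"
  define G where "G = (\<Sum>i\<in>UNIV. smult (d $ i) (along v2 v1 (\<theta> $ i)))"
  have poly_FG: "poly F s = dot c (eval_der \<theta> (q s))" "poly G s = dot d (eval_der \<theta> (q s))" for s
    by (simp_all add: F_def G_def poly_sum poly_along dot_def eval_der_def q_def)
  have deg: "degree F \<le> r" "degree G \<le> r"
    using \<theta> unfolding F_def G_def
    by (auto intro!: degree_sum_le order_trans[OF degree_smult_le] degree_along_le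
        simp: has_der_iff)
  have \<theta>_H: "eval_der \<theta> x \<in> H" for x
    using \<theta> H by (simp add: eval_at_der_apply[symmetric] has_der_iff eval_at_hom mem_line)
  have \<theta>_FG: "eval_der \<theta> (q s) = poly F s *s v1 + poly G s *s v2" for s
    using gen[OF \<theta>_H[of "q s"]] by (simp only: poly_FG)
  have tangent: "poly F t = t * poly G t \<and> poly (pderiv F) t = t * poly (pderiv G) t"
    if t: "t \<in> T ` M" for t
  proof -
    obtain p where p: "p \<in> restriction \<A> H" "card (lines_through \<A> p) \<ge> 3" "t = T p"
      using t by (auto simp: M_def)
    obtain L1 L2 where L: "L1 \<in> \<A>" "L2 \<in> \<A>" "L1 \<noteq> L2" "L1 \<noteq> H" "L2 \<noteq> H" "p \<subseteq> L1" "p \<subseteq> L2"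
      using on_two_other_lines[OF p(2)] by metis
    have qt: "q t \<in> L1" "q t \<in> L2"
      using q_p[OF p(1)] p(3) L by auto
    have "linear_form (\<alpha> L2) dvd der_apply \<theta> (linear_form (\<alpha> L2))"
      using \<theta> L by (simp add: has_der_iff)
    then obtain \<psi> where \<psi>: "der_apply \<theta> (linear_form (\<alpha> L2)) = linear_form (\<alpha> L2) * \<psi>"
      by (rule dvdE)
    define B where "B = along v2 v1 \<psi>"
    define a where "a = dot (\<alpha> L2) v1"
    have "a \<noteq> 0"
      using v1(3) L by (simp add: a_def mem_line)
    \<comment> \<open>Hence the form of \<open>L2\<close> restricts to \<open>a * (s - t)\<close> on
      the affine line.\<close>
    have a2: "dot (\<alpha> L2) v2 = - t * a"
      using qt(2) L by (simp add: a_def mem_line q_def dot_add dot_mult eq_neg_iff_add_eq_0)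
    \<comment> \<open>This is the equation for \<open>\<psi>\<close> evaluated at
      \<open>q s\<close>, with the common factor \<open>a\<close> cancelled.\<close>
    have "poly (F - smult t G) s = poly ([:- t, 1:] * B) s" for s
    proof -
      have "dot (\<alpha> L2) (eval_der \<theta> (q s)) = dot (\<alpha> L2) (q s) * eval_at (q s) \<psi>"
        using arg_cong[OF \<psi>, of "eval_at (q s)"]
        by (simp add: eval_at_der_apply eval_at_hom eval_at_linear_form)
      moreover have "dot (\<alpha> L2) (eval_der \<theta> (q s)) = a * (poly F s - t * poly G s)"
        unfolding \<theta>_FG dot_add dot_mult a2 a_def[symmetric] by (simp add: algebra_simps)
      moreover have "dot (\<alpha> L2) (q s) = a * (s - t)"
        unfolding q_def dot_add dot_mult a2 a_def[symmetric] by (simp add: algebra_simps)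
      moreover have "eval_at (q s) \<psi> = poly B s"
        by (simp add: B_def poly_along q_def)
      ultimately have "a * (poly F s - t * poly G s) = a * ((s - t) * poly B s)"
        by simp
      then have "poly F s - t * poly G s = (s - t) * poly B s"
        using \<open>a \<noteq> 0\<close> by simp
      then show ?thesis
        by (simp add: algebra_simps)
    qed
    then have FG: "F - smult t G = [:- t, 1:] * B"
      using poly_eq_poly_eq_iff by blast
    have B: "poly B t = 0"
      using quotient_vanishes[OF H L(1,2,4,3) q(1) qt q(2) \<theta> \<psi>] by (simp add: B_def poly_along q_def)
    \<comment> \<open>Since \<open>B\<close> vanishes at \<open>t\<close>, this zero is double. Here
      \<open>t\<close> is a constant, so the derivative is \<open>F' - t G'\<close>.\<close>
    have "poly (F - smult t G) t = 0" "poly (pderiv (F - smult t G)) t = 0"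
      unfolding FG pderiv_mult using B by (simp_all add: pderiv_pCons)
    then show ?thesis
      by (simp add: pderiv_diff pderiv_smult)
  qed
  show "card {p \<in> restriction \<A> H. card (lines_through \<A> p) \<ge> 3} \<le> r"
  proof (rule ccontr)
    assume "\<not> ?thesis"
    then have "card (T ` M) > r"
      using T_inj by (subst card_image) (auto simp: M_def elim: inj_on_subset)
    then have "F = 0" "G = 0"
      using tangent_pencil_zero[OF has_der_degree_pos[OF \<theta>] deg] tangent by blast+
    then have zero: "eval_der \<theta> (q s) = 0" for s
      by (simp add: \<theta>_FG)
    have hom: "eval_der \<theta> (k *s x) = k ^ r *s eval_der \<theta> x" for k x
      using \<theta> by (simp add: has_der_iff eval_der_def vec_eq_iff eval_at_homogeneous)
    \<comment> \<open>Homogeneity carries the zero from the affine line to every vector of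
      \<open>H\<close> with nonzero \<open>v2\<close>-coordinate.\<close>
    have off: "eval_der \<theta> (k *s v1 + s *s v2) = 0" if "s \<noteq> 0" for k s
    proof -
      have "k *s v1 + s *s v2 = s *s q (k / s)"
        using that by (simp add: q_def vector_add_ldistrib vector_smult_assoc add.commute)
      then show ?thesis
        by (simp add: hom zero)
    qed
    have "eval_der \<theta> x = 0" if x: "x \<in> H" for x
    proof (cases "dot d x = 0")
      case False
      then show ?thesis
        using off gen[OF x] by metis
    next
      case True
      \<comment> \<open>The remaining multiples of \<open>v1\<close> are reached by moving off in
        direction \<open>v2\<close> and specialising the parameter to 0.\<close>
      have "along x v2 (\<theta> $ i) = 0" for i
      proof (rule poly_eq_0_offI)
        fix s :: 'k assume "s \<noteq> 0"
        then have "eval_der \<theta> (dot c x *s v1 + s *s v2) = 0"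
          by (rule off)
        moreover have "x = dot c x *s v1"
          using gen[OF x] True by simp
        ultimately have "eval_der \<theta> (x + s *s v2) = 0"
          by simp
        then show "poly (along x v2 (\<theta> $ i)) s = 0"
          by (simp add: poly_along eval_der_def vec_eq_iff)
      qed
      then have "poly (along x v2 (\<theta> $ i)) 0 = 0" for i
        by simp
      then show ?thesis
        by (simp add: poly_along eval_der_def vec_eq_iff)
    qed
    then show False
      using has_der_not_vanishing[OF H \<theta> min] by blast
  qed
qed

section \<open>Counting double points\<close>

text \<open>A point on \<open>H\<close> is double or lies on at least three lines. The additive form
  avoids truncated subtraction.\<close>

lemma card_restriction_le:
  assumes "L\<^sub>0 \<in> \<A>" "H \<in> \<A>"
  shows "card (restriction \<A> H) \<le> n2_on \<A> H + mdr \<A> \<alpha> L\<^sub>0" "finite (restriction \<A> H)"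
proof -
  obtain \<theta> where "has_der (mdr \<A> \<alpha> L\<^sub>0) H \<theta>"
    using mdr_eq(1)[OF assms] by blast
  note * = multiple_points_le[OF assms(2) this mdr_eq(2)[OF assms]]
  show "finite (restriction \<A> H)" by (rule *)
  let ?M = "{p \<in> restriction \<A> H. card (lines_through \<A> p) \<ge> 3}"
    and ?D = "{p \<in> double_points \<A>. p \<subseteq> H}"
  have "restriction \<A> H = ?D \<union> ?M"
    by (auto simp: restriction_def intersection_points_def double_points_def)
  then have "card (restriction \<A> H) = card (?D \<union> ?M)"
    by (rule arg_cong)
  also have "\<dots> \<le> card ?D + card ?M"
    by (rule card_Un_le)
  also have "\<dots> \<le> n2_on \<A> H + mdr \<A> \<alpha> L\<^sub>0"
    using *(2) by (simp add: n2_on_def)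
  finally show "card (restriction \<A> H) \<le> n2_on \<A> H + mdr \<A> \<alpha> L\<^sub>0" .
qed

text \<open>Double counting of incidences: a double point lies on exactly two lines. There are
  finitely many, since each belongs to some \<open>restriction\<close>.\<close>

lemma sum_n2_on:
  assumes "L\<^sub>0 \<in> \<A>"
  shows "(\<Sum>L\<in>\<A>. n2_on \<A> L) = 2 * n2 \<A>"
proof -
  have "double_points \<A> \<subseteq> (\<Union>L\<in>\<A>. restriction \<A> L)"
  proof
    fix p assume p: "p \<in> double_points \<A>"
    then have i: "p \<in> intersection_points \<A>"
      by (simp add: double_points_def intersection_points_def)
    then show "p \<in> (\<Union>L\<in>\<A>. restriction \<A> L)"
      using on_another_line[OF i] by (auto simp: restriction_def)
  qed
  then have fin: "finite (double_points \<A>)"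
    using finite_lines card_restriction_le(2)[OF assms] by (auto intro: finite_subset)
  have "(\<Sum>L\<in>\<A>. n2_on \<A> L) = (\<Sum>p\<in>double_points \<A>. 2)"
    unfolding n2_on_def using finite_lines fin
    by (intro sum_multicount_gen) (auto simp: double_points_def lines_through_def)
  then show ?thesis
    by (simp add: n2_def)
qed

end

theorem theorem3p3:
  fixes \<A> :: "('k::field_char_0 ^ 3) set set"
    and \<alpha> :: "('k ^ 3) set \<Rightarrow> 'k ^ 3"
    and L\<^sub>0 :: "('k ^ 3) set"
    and r :: nat
  assumes "line_arrangement \<A> \<alpha>"
    and "L\<^sub>0 \<in> \<A>"
    and "r = mdr \<A> \<alpha> L\<^sub>0"
  shows "(\<forall>H\<in>\<A>. \<forall>k. card (restriction \<A> H) = k \<longrightarrow> k > r \<longrightarrow>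
             real (n2_on \<A> H) \<ge> real k - real r) \<and>
         real (n2 \<A>) \<ge>
           1 / 2 * (\<Sum>L\<in>lines_gt \<A> r. real (card (restriction \<A> L)) - real r) \<and>
         real (n2 \<A>) \<ge> real (card (lines_gt \<A> r)) / 2 \<and>
         (lines_gt \<A> r \<noteq> {} \<longrightarrow> n2 \<A> > 0)"
proof -
  interpret arrangement \<A> \<alpha>
    by unfold_locales (rule assms(1))
  let ?S = "\<Sum>L\<in>lines_gt \<A> r. real (card (restriction \<A> L)) - real r"
  have on: "real (card (restriction \<A> H)) - real r \<le> real (n2_on \<A> H)" if "H \<in> \<A>" for H
    using card_restriction_le(1)[OF assms(2) that] assms(3) by simp
  have sub: "lines_gt \<A> r \<subseteq> \<A>" and fin: "finite (lines_gt \<A> r)"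
    using finite_lines by (auto simp: lines_gt_def)
  have "?S \<le> (\<Sum>L\<in>lines_gt \<A> r. real (n2_on \<A> L))"
    using sub on by (intro sum_mono) auto
  also have "\<dots> \<le> (\<Sum>L\<in>\<A>. real (n2_on \<A> L))"
    using sub finite_lines by (intro sum_mono2) auto
  also have "\<dots> = real (\<Sum>L\<in>\<A>. n2_on \<A> L)"
    by simp
  also have "\<dots> = 2 * real (n2 \<A>)"
    unfolding sum_n2_on[OF assms(2)] by simp
  finally have S: "?S \<le> 2 * real (n2 \<A>)" .
  have "real (card (lines_gt \<A> r)) = (\<Sum>L\<in>lines_gt \<A> r. 1)"
    by simp
  \<comment> \<open>Each summand is a positive difference of natural numbers, hence at least
    1.\<close>
  also have "\<dots> \<le> ?S"
    by (intro sum_mono) (auto simp: lines_gt_def)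
  finally have card: "real (card (lines_gt \<A> r)) \<le> ?S" .
  have "n2 \<A> > 0" if "lines_gt \<A> r \<noteq> {}"
  proof -
    have "0 < real (card (lines_gt \<A> r))"
      using that fin by (simp add: card_gt_0_iff)
    then have "0 < real (n2 \<A>)"
      using card S by linarith
    then show ?thesis by simp
  qed
  moreover have "1 / 2 * ?S \<le> real (n2 \<A>)" "real (card (lines_gt \<A> r)) / 2 \<le> real (n2 \<A>)"
    using S card by linarith+
  ultimately show ?thesis
    using on by blast
qed

end
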